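(* Fix a prime power $q$ and an integer $i\ge0$. Then the assignment $[n]\mapsto H^i(B(n,q),\mathbf F_q)$ is an $\mathcal H$-module over $\mathbf F_q$, where $\pi_j\in H_n(0)$ ($1\le j\le n-1$) acts on $H^i(B(n,q),\mathbf F_q)$ by $\mathfrak T(E_{j,j+1})+\mathrm{id}$ and the morphism $\iota_{n,n+1}:[n]\to[n+1]$ acts by $\Phi_n:H^i(B(n,q),\mathbf F_q)\to H^i(B(n+1,q),\mathbf F_q)$.
   Context: Here the base field is $\mathbf k=\mathbf F_q$. For $n\ge 0$ let $[n]=\{1,\dots,n\}$, and let $H_n(0)$ be the unital associative $\mathbf k$-algebra generated by $\pi_1,\dots,\pi_{n-1}$ with relations $\pi_i^2=\pi_i$, $\pi_i\pi_{i+1}\pi_i=\pi_{i+1}\pi_i\pi_{i+1}$, and $\pi_i\pi_j=\pi_j\pi_i$ for $|i-j|>1$. For $w\in\mathfrak S_n$ with reduced expression $w=s_{i_1}\cdots s_{i_r}$ in the adjacent transpositions $s_i=(i,i+1)$, put $\pi_w=\pi_{i_1}\cdots\pi_{i_r}$; the $\pi_w$ form a basis of $H_n(0)$ and a monoid $\mathcal M_n$ under multiplication. For $n\le m$, $\mathcal M_n\subseteq\mathcal M_m$ via $\pi_i\mapsto\pi_i$. The $0$-Hecke category $\mathcal H$ has objects $[n]$, $n\ge0$. For $n\le m$, $\mathrm{Hom}_{\mathcal H}([n],[m])$ is the set of braid diagrams from $n$ top vertices to $m$ bottom vertices with only positive crossings, modulo $\pi_i^2=\pi_i$, composed by padding with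 dummy strands, multiplying in the $0$-Hecke monoid and deleting dummy strands; there are no morphisms if $n>m$. Algebraically, $\mathrm{Hom}_{\mathcal H}([n],[m])$ is the quotient of $\mathcal M_m$ by the equivalence relation generated by $x\sim x\pi_j$ for $n+1\le j\le m-1$, and the composite of the class of $y\in\mathcal M_\ell$ in $\mathrm{Hom}([m],[\ell])$ with the class of $x\in\mathcal M_m$ in $\mathrm{Hom}([n],[m])$ is the class of $yx\in\mathcal M_\ell$. The principal injection $\iota_{n,m}\in\mathrm{Hom}_{\mathcal H}([n],[m])$ is the class of $1$. An $\mathcal H$-module is a functor $V$ from $\mathcal H$ to $\mathbf k$-vector spaces; $V_n=V([n])$ is an $H_n(0)$-module since $\mathrm{End}_{\mathcal H}([n])=\mathcal M_n$. $B(n,q)\subset\mathrm{GL}_n(\mathbf F_q)$ is the group of invertible upper triangular matrices, and $\mathbf F_q$ is the trivial module. $H^i(\Gamma,\mathbf F_q)$ is computed from the complex $\mathfrak C^i(\Gamma,\mathbf F_q)$ of homogeneous cochains, i.e. functions $\phi:\Gamma^{i+1}\to\mathbf F_q$ with $\phi(\gamma\gamma_0,\dots,\gamma\gamma_i)=\phi(\gamma_0,\dots,\gamma_i)$, with differential $(\delta\phi)(\gamma_0,\dots,\gamma_{i+1})=\sum_j(-1)^j\phi(\gamma_0,\dots,\widehat{\gamma_j},\dots,\gamma_{i+1})$. Let $\Gamma=B(n,q)$ and let $E_{j,j+1}$ be the $n\times n$ permutation matrix swapping $j$ and $j+1$. Write $\Gamma E_{j,j+1}\Gamma=\bigsqcup_{s=1}^{d}\Gamma\alpha_s$.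 For $\gamma\in\Gamma$ and each $s$ there are a unique $\xi_s(\gamma)\in\Gamma$ and a unique index $s'$ with $\alpha_s\gamma=\xi_s(\gamma)\alpha_{s'}$. The operator $\mathfrak T(E_{j,j+1})$ on $H^i(\Gamma,\mathbf F_q)$ is induced by the map on cochains $(\mathfrak T(E_{j,j+1})\psi)(\gamma_0,\dots,\gamma_i)=\sum_{s=1}^d\alpha_s^{-1}\psi(\xi_s(\gamma_0),\dots,\xi_s(\gamma_i))$, where $\alpha_s^{-1}$ acts trivially on $\mathbf F_q$ (this is the standard Hecke operator of the double coset, independent of the choice of representatives on cohomology). $\Phi_n$ is the map on cohomology induced by the group homomorphism $r_{n+1,n}:B(n+1,q)\to B(n,q)$ that restricts a matrix to its first $n$ rows and first $n$ columns. *)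

theory Defs
  imports
    "Jordan_Normal_Form.VS_Connect"
    "Jordan_Normal_Form.Gauss_Jordan_Elimination"
    "HOL-Algebra.AbelCoset"
    "HOL-Library.Disjoint_Sets"
begin

section \<open>The 0-Hecke monoids\<close>

text \<open>
  A word \<open>[i\<^sub>1, \<dots>, i\<^sub>r]\<close> stands for \<open>\<pi>\<^bsub>i\<^sub>1\<^esub> \<cdots> \<pi>\<^bsub>i\<^sub>r\<^esub>\<close>.  Every defining relation of the 0-Hecke
  algebra equates two monomials, so the monoid of all monomials is the monoid presented by the same
  relations (positive braids modulo \<open>\<pi>\<^sub>i\<^sup>2 = \<pi>\<^sub>i\<close>).  Each class of words contains a reduced word, so the
  monomials are exactly the elements \<open>\<pi>\<^sub>w\<close>.
\<close>

inductive hecke_relation :: "nat list \<Rightarrow> nat list \<Rightarrow> bool" where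
  idem: "hecke_relation [i, i] [i]"
| braid: "hecke_relation [i, i + 1, i] [i + 1, i, i + 1]"
| comm: "\<bar>int i - int j\<bar> > 1 \<Longrightarrow> hecke_relation [i, j] [j, i]"

inductive hecke_step :: "nat list \<Rightarrow> nat list \<Rightarrow> bool" where
  "hecke_relation l r \<Longrightarrow> hecke_step (u @ l @ v) (u @ r @ v)"

definition hecke_eq :: "nat list \<Rightarrow> nat list \<Rightarrow> bool" where
  "hecke_eq = equivclp hecke_step"

lemma equivp_hecke_eq: "equivp hecke_eq"
  by (simp add: hecke_eq_def equivpI)

quotient_type hecke_monoid = "nat list" / hecke_eq
  by (rule equivp_hecke_eq)

lemma hecke_step_append:
  assumes "hecke_step a b"
  shows "hecke_step (u @ a @ v) (u @ b @ v)"
  using assms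
proof cases
  case (1 l r p s)
  have "hecke_step ((u @ p) @ l @ (s @ v)) ((u @ p) @ r @ (s @ v))"
    using 1(3) by (rule hecke_step.intros)
  with 1 show ?thesis by simp
qed

lemma hecke_eq_append:
  assumes "hecke_eq a b"
  shows "hecke_eq (u @ a @ v) (u @ b @ v)"
  using assms unfolding hecke_eq_def
proof (induction rule: equivclp_induct)
  case base
  then show ?case by simp
next
  case (step y z)
  then have "symclp hecke_step (u @ y @ v) (u @ z @ v)"
    by (auto simp: symclp_def intro: hecke_step_append)
  with step.IH show ?case
    unfolding equivclp_def by (rule rtranclp.rtrancl_into_rtrancl)
qed

instantiation hecke_monoid :: monoid_mult
begin

lift_definition one_hecke_monoid :: hecke_monoid is "[]" .

lift_definition times_hecke_monoid :: "hecke_monoid \<Rightarrow> hecke_monoid \<Rightarrow> hecke_monoid" is "(@)"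
proof -
  fix a b c d :: "nat list"
  assume "hecke_eq a b" "hecke_eq c d"
  then have "hecke_eq (a @ c) (b @ c)" "hecke_eq (b @ c) (b @ d)"
    using hecke_eq_append[of a b "[]" c] hecke_eq_append[of c d b "[]"] by auto
  then show "hecke_eq (a @ c) (b @ d)"
    using equivp_hecke_eq by (blast intro: equivp_transp)
qed

instance
  by standard (transfer, simp add: equivp_reflp[OF equivp_hecke_eq])+

end

lift_definition hecke_gen :: "nat \<Rightarrow> hecke_monoid" (\<open>\<pi>\<close>) is "\<lambda>i. [i]" .

text \<open>
  The monoid \<open>\<M>\<^sub>n\<close> is generated by \<open>\<pi>\<^sub>1, \<dots>, \<pi>\<^bsub>n-1\<^esub>\<close>.  Its only relations are those among these
  generators, because equivalent words use the same letters (lemma \<open>hecke_eq_set\<close>); in particular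
  \<open>\<M>\<^sub>n \<subseteq> \<M>\<^sub>m\<close> for \<open>n \<le> m\<close>.
\<close>

definition zero_hecke :: "nat \<Rightarrow> hecke_monoid set" (\<open>\<M>\<close>) where
  "\<M> n = {prod_list (map \<pi> u) | u. set u \<subseteq> {1..<n}}"

lemma hecke_eq_set:
  assumes "hecke_eq u v"
  shows "set u = set v"
  using assms unfolding hecke_eq_def
proof (induction rule: equivclp_induct)
  case (step y z)
  have "set a = set b" if "hecke_step a b" for a b
    using that
  proof cases
    case (1 l r u v)
    from \<open>hecke_relation l r\<close> have "set l = set r"
      by cases auto
    with 1 show ?thesis
      by simp
  qed
  with step show ?case
    unfolding symclp_def by metis
qed simp

section \<open>The 0-Hecke category\<close>

text \<open>
  The objects are the natural numbers, \<open>n\<close> standing for \<open>[n]\<close>.  The same set of monoid elements may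
  occur in several Hom-sets, so source and target are carried along as indices.
\<close>

definition hom_equiv :: "nat \<Rightarrow> nat \<Rightarrow> (hecke_monoid \<times> hecke_monoid) set" where
  "hom_equiv n m = {(x, y). x \<in> \<M> m \<and> y \<in> \<M> m \<and>
     equivclp (\<lambda>a b. a \<in> \<M> m \<and> (\<exists>j. n + 1 \<le> j \<and> j < m \<and> b = a * \<pi> j)) x y}"

definition hecke_Hom :: "nat \<Rightarrow> nat \<Rightarrow> hecke_monoid set set" where
  "hecke_Hom n m = (if n \<le> m then \<M> m // hom_equiv n m else {})"

definition hom_class :: "nat \<Rightarrow> nat \<Rightarrow> hecke_monoid \<Rightarrow> hecke_monoid set" where
  "hom_class n m x = hom_equiv n m `` {x}"

text \<open>The composite of \<open>Y : [m] \<rightarrow> [l]\<close> with \<open>X : [n] \<rightarrow> [m]\<close>; see \<open>hecke_comp_class\<close> below.\<close>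

definition hecke_comp ::
  "nat \<Rightarrow> nat \<Rightarrow> hecke_monoid set \<Rightarrow> hecke_monoid set \<Rightarrow> hecke_monoid set" where
  "hecke_comp n l Y X = (\<Union>y\<in>Y. \<Union>x\<in>X. hom_class n l (y * x))"

lemma gen_in_zero_hecke: "1 \<le> j \<Longrightarrow> j < m \<Longrightarrow> \<pi> j \<in> \<M> m"
  unfolding zero_hecke_def by (auto intro!: exI[of _ "[j]"])

lemma mult_in_zero_hecke:
  assumes "x \<in> \<M> m" "y \<in> \<M> m"
  shows "x * y \<in> \<M> m"
proof -
  from assms obtain u v where "x = prod_list (map \<pi> u)" "y = prod_list (map \<pi> v)"
      "set u \<subseteq> {1..<m}" "set v \<subseteq> {1..<m}"
    unfolding zero_hecke_def by blast
  then have "x * y = prod_list (map \<pi> (u @ v))" "set (u @ v) \<subseteq> {1..<m}"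
    by auto
  then show ?thesis
    unfolding zero_hecke_def by blast
qed

lemma zero_hecke_mono:
  assumes "n \<le> m"
  shows "\<M> n \<subseteq> \<M> m"
proof -
  have "{1..<n} \<subseteq> {1..<m}"
    using assms by auto
  then show ?thesis
    unfolding zero_hecke_def by blast
qed

lemma gen_commute: "\<bar>int i - int j\<bar> > 1 \<Longrightarrow> \<pi> i * \<pi> j = \<pi> j * \<pi> i"
proof (transfer, goal_cases)
  case (1 i j)
  then have "hecke_step ([] @ [i, j] @ []) ([] @ [j, i] @ [])"
    by (intro hecke_step.intros hecke_relation.comm)
  then show ?case
    by (auto simp: hecke_eq_def equivclp_def symclp_def)
qed

lemma gen_commute_zero_hecke:
  assumes "x \<in> \<M> m" "m < j"
  shows "\<pi> j * x = x * \<pi> j"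
proof -
  have "\<pi> j * prod_list (map \<pi> u) = prod_list (map \<pi> u) * \<pi> j" if "set u \<subseteq> {1..<m}" for u
    using that
  proof (induction u)
    case (Cons a u)
    then have "\<pi> j * \<pi> a = \<pi> a * \<pi> j"
      using \<open>m < j\<close> by (intro gen_commute) auto
    with Cons show ?case
      by simp (metis mult.assoc)
  qed simp
  with assms show ?thesis
    unfolding zero_hecke_def by auto
qed

lemma equiv_hom_equiv: "equiv (\<M> m) (hom_equiv n m)"
  unfolding hom_equiv_def
  by (intro equivI refl_onI symI transI)
    (auto intro: equivclp_sym equivclp_trans)

lemma hom_equiv_mult_left:
  assumes "(x, x') \<in> hom_equiv n m" "y \<in> \<M> l" "m \<le> l"
  shows "(y * x, y * x') \<in> hom_equiv n l"
proof -
  have *: "equivclp (\<lambda>a b. a \<in> \<M> l \<and> (\<exists>j. n + 1 \<le> j \<and> j < l \<and> b = a * \<pi> j)) (y * x) (y * x')"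
    if "equivclp (\<lambda>a b. a \<in> \<M> m \<and> (\<exists>j. n + 1 \<le> j \<and> j < m \<and> b = a * \<pi> j)) x x'"
    using that
  proof (induction rule: equivclp_induct)
    case (step b c)
    then have "symclp (\<lambda>a b. a \<in> \<M> l \<and> (\<exists>j. n + 1 \<le> j \<and> j < l \<and> b = a * \<pi> j)) (y * b) (y * c)"
      using assms(2,3) zero_hecke_mono[OF assms(3)] mult_in_zero_hecke[OF assms(2)]
      by (force simp: symclp_def mult.assoc)
    with step.IH show ?case
      unfolding equivclp_def by (rule rtranclp.rtrancl_into_rtrancl)
  qed simp
  then show ?thesis
    using assms zero_hecke_mono[OF assms(3)] mult_in_zero_hecke[OF assms(2)]
    by (auto simp: hom_equiv_def)
qed

lemma hom_equiv_mult_right: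
  assumes "(y, y') \<in> hom_equiv m l" "x \<in> \<M> m" "n \<le> m" "m \<le> l"
  shows "(y * x, y' * x) \<in> hom_equiv n l"
proof -
  have x: "x \<in> \<M> l"
    using assms zero_hecke_mono by blast
  have *: "equivclp (\<lambda>a b. a \<in> \<M> l \<and> (\<exists>j. n + 1 \<le> j \<and> j < l \<and> b = a * \<pi> j)) (y * x) (y' * x)"
    if "equivclp (\<lambda>a b. a \<in> \<M> l \<and> (\<exists>j. m + 1 \<le> j \<and> j < l \<and> b = a * \<pi> j)) y y'"
    using that
  proof (induction rule: equivclp_induct)
    case (step b c)
    have "b * \<pi> j * x = b * x * \<pi> j" if "m + 1 \<le> j" for b j
      using gen_commute_zero_hecke[OF assms(2), of j] that by (simp add: mult.assoc)
    moreover have "n + 1 \<le> j" if "m + 1 \<le> j" for j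
      using that assms(3) by simp
    ultimately have shift: "b * x \<in> \<M> l \<and> (\<exists>j. n + 1 \<le> j \<and> j < l \<and> c * x = b * x * \<pi> j)"
      if "b \<in> \<M> l \<and> (\<exists>j. m + 1 \<le> j \<and> j < l \<and> c = b * \<pi> j)" for b c
      using that mult_in_zero_hecke[OF _ x] by blast
    have "symclp (\<lambda>a b. a \<in> \<M> l \<and> (\<exists>j. n + 1 \<le> j \<and> j < l \<and> b = a * \<pi> j)) (b * x) (c * x)"
      using step.hyps(2) shift unfolding symclp_def by blast
    with step.IH show ?case
      unfolding equivclp_def by (rule rtranclp.rtrancl_into_rtrancl)
  qed simp
  then show ?thesis
    using assms x by (auto simp: hom_equiv_def intro: mult_in_zero_hecke)
qed

lemma hecke_comp_class:
  assumes "x \<in> \<M> m" "y \<in> \<M> l" "n \<le> m" "m \<le> l"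
  shows "hecke_comp n l (hom_class m l y) (hom_class n m x) = hom_class n l (y * x)"
proof -
  have "hom_class n l (y' * x') = hom_class n l (y * x)"
    if "y' \<in> hom_class m l y" "x' \<in> hom_class n m x" for x' y'
  proof -
    have y': "(y, y') \<in> hom_equiv m l" and x': "(x, x') \<in> hom_equiv n m"
      using that by (auto simp: hom_class_def)
    from y' have "y' \<in> \<M> l"
      by (simp add: hom_equiv_def)
    have "(y * x, y' * x) \<in> hom_equiv n l" "(y' * x, y' * x') \<in> hom_equiv n l"
      using hom_equiv_mult_right[OF y' assms(1,3,4)]
        hom_equiv_mult_left[OF x' \<open>y' \<in> \<M> l\<close> assms(4)] by simp_all
    then have "(y * x, y' * x') \<in> hom_equiv n l"
      using equiv_hom_equiv[of l n] unfolding equiv_def by (blast dest: transD)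
    then show ?thesis
      unfolding hom_class_def by (rule equiv_class_eq[OF equiv_hom_equiv, symmetric])
  qed
  moreover have "y \<in> hom_class m l y" "x \<in> hom_class n m x"
    using assms equiv_class_self[OF equiv_hom_equiv] by (auto simp: hom_class_def)
  ultimately show ?thesis
    unfolding hecke_comp_def by blast
qed

definition principal_inj :: "nat \<Rightarrow> nat \<Rightarrow> hecke_monoid set" (\<open>\<iota>\<close>) where
  "\<iota> n m = hom_class n m 1"

locale hecke_category_module =
  fixes V :: "nat \<Rightarrow> ('k::field, 'v) module"
    and F :: "nat \<Rightarrow> nat \<Rightarrow> hecke_monoid set \<Rightarrow> 'v \<Rightarrow> 'v"
  assumes space: "vectorspace class_ring (V n)"
    and linear: "f \<in> hecke_Hom n m \<Longrightarrow> linear_map class_ring (V n) (V m) (F n m f)"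
    and ident: "x \<in> carrier (V n) \<Longrightarrow> F n n (hom_class n n 1) x = x"
    and comp: "\<lbrakk>f \<in> hecke_Hom n m; g \<in> hecke_Hom m l; x \<in> carrier (V n)\<rbrakk>
      \<Longrightarrow> F n l (hecke_comp n l g f) x = F m l g (F n m f x)"

section \<open>Group cohomology with trivial coefficients\<close>

text \<open>
  Homogeneous \<open>i\<close>-cochains are functions on \<open>(i + 1)\<close>-tuples, which are lists here.  They are
  extended by \<open>0\<close> to all other lists, so that equality of cochains is equality of functions.
\<close>

definition tuples :: "('g, 'b) monoid_scheme \<Rightarrow> nat \<Rightarrow> 'g list set" where
  "tuples G i = {gs. length gs = i + 1 \<and> set gs \<subseteq> carrier G}"

definition cochains :: "('g, 'b) monoid_scheme \<Rightarrow> nat \<Rightarrow> ('g list \<Rightarrow> 'k::field) set" where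
  "cochains G i = {\<phi>. (\<forall>gs. gs \<notin> tuples G i \<longrightarrow> \<phi> gs = 0) \<and>
     (\<forall>g\<in>carrier G. \<forall>gs\<in>tuples G i. \<phi> (map (\<lambda>h. g \<otimes>\<^bsub>G\<^esub> h) gs) = \<phi> gs)}"

definition cochain_space ::
  "('g, 'b) monoid_scheme \<Rightarrow> nat \<Rightarrow> ('k::field, 'g list \<Rightarrow> 'k) module" where
  "cochain_space G i = \<lparr>carrier = cochains G i, mult = undefined, one = undefined,
     zero = (\<lambda>_. 0), add = (\<lambda>\<phi> \<psi> gs. \<phi> gs + \<psi> gs), smult = (\<lambda>a \<phi> gs. a * \<phi> gs)\<rparr>"

definition differential ::
  "('g, 'b) monoid_scheme \<Rightarrow> nat \<Rightarrow> ('g list \<Rightarrow> 'k::field) \<Rightarrow> 'g list \<Rightarrow> 'k" where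
  "differential G i \<phi> = (\<lambda>gs. if gs \<in> tuples G (i + 1)
     then \<Sum>j\<le>i + 1. (- 1) ^ j * \<phi> (take j gs @ drop (j + 1) gs) else 0)"

definition cocycles :: "('g, 'b) monoid_scheme \<Rightarrow> nat \<Rightarrow> ('g list \<Rightarrow> 'k::field) set" where
  "cocycles G i = {\<phi> \<in> cochains G i. differential G i \<phi> = (\<lambda>_. 0)}"

definition coboundaries :: "('g, 'b) monoid_scheme \<Rightarrow> nat \<Rightarrow> ('g list \<Rightarrow> 'k::field) set" where
  "coboundaries G i = (case i of 0 \<Rightarrow> {\<lambda>_. 0} | Suc k \<Rightarrow> differential G k ` cochains G k)"

definition quotient_module :: "('r, 'm) module \<Rightarrow> 'm set \<Rightarrow> ('r, 'm set) module" where
  "quotient_module M N = \<lparr>carrier = a_rcosets\<^bsub>M\<^esub> N, mult = undefined, one = undefined,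
     zero = N, add = (<+>\<^bsub>M\<^esub>), smult = (\<lambda>a X. \<Union>x\<in>X. N +>\<^bsub>M\<^esub> (a \<odot>\<^bsub>M\<^esub> x))\<rparr>"

definition cohomology ::
  "('g, 'b) monoid_scheme \<Rightarrow> nat \<Rightarrow> ('k::field, ('g list \<Rightarrow> 'k) set) module" where
  "cohomology G i =
     quotient_module ((cochain_space G i)\<lparr>carrier := cocycles G i\<rparr>) (coboundaries G i)"

text \<open>
  The map into the cohomology of \<open>G\<close> induced by a cochain map \<open>f\<close>.  The union is a single coset, and
  hence an element of \<^term>\<open>carrier (cohomology G i)\<close>, only if the class of \<open>f \<phi>\<close> does not depend on
  the choice of \<open>\<phi>\<close> in its class.
\<close>

definition cohomology_map ::
  "('g, 'b) monoid_scheme \<Rightarrow> nat \<Rightarrow> ('s \<Rightarrow> 'g list \<Rightarrow> 'k::field) \<Rightarrow> 's set \<Rightarrow> ('g list \<Rightarrow> 'k) set"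
where
  "cohomology_map G i f X = (\<Union>\<phi>\<in>X. coboundaries G i +>\<^bsub>cochain_space G i\<^esub> f \<phi>)"

definition pullback ::
  "('g, 'b) monoid_scheme \<Rightarrow> nat \<Rightarrow> ('g \<Rightarrow> 'h) \<Rightarrow> ('h list \<Rightarrow> 'k::field) \<Rightarrow> 'g list \<Rightarrow> 'k" where
  "pullback G i r \<psi> = (\<lambda>gs. if gs \<in> tuples G i then \<psi> (map r gs) else 0)"

section \<open>Hecke operators\<close>

text \<open>Below, \<open>\<Gamma>\<close> is the carrier of a subgroup of the ambient group \<open>G\<close>.\<close>

definition double_coset :: "('g, 'b) monoid_scheme \<Rightarrow> 'g set \<Rightarrow> 'g \<Rightarrow> 'g set" where
  "double_coset G \<Gamma> g = (\<Gamma> #>\<^bsub>G\<^esub> g) <#>\<^bsub>G\<^esub> \<Gamma>"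

definition coset_reps :: "('g, 'b) monoid_scheme \<Rightarrow> 'g set \<Rightarrow> 'g \<Rightarrow> 'g set \<Rightarrow> bool" where
  "coset_reps G \<Gamma> g R \<longleftrightarrow> R \<subseteq> carrier G \<and>
     double_coset G \<Gamma> g = (\<Union>\<alpha>\<in>R. \<Gamma> #>\<^bsub>G\<^esub> \<alpha>) \<and> disjoint_family_on (\<lambda>\<alpha>. \<Gamma> #>\<^bsub>G\<^esub> \<alpha>) R"

definition hecke_xi :: "('g, 'b) monoid_scheme \<Rightarrow> 'g set \<Rightarrow> 'g set \<Rightarrow> 'g \<Rightarrow> 'g \<Rightarrow> 'g" where
  "hecke_xi G \<Gamma> R \<alpha> \<gamma> = (THE \<xi>. \<xi> \<in> \<Gamma> \<and> (\<exists>\<beta>\<in>R. \<alpha> \<otimes>\<^bsub>G\<^esub> \<gamma> = \<xi> \<otimes>\<^bsub>G\<^esub> \<beta>))"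

definition hecke_cochain_map :: "('g, 'b) monoid_scheme \<Rightarrow> 'g set \<Rightarrow> 'g set \<Rightarrow> nat \<Rightarrow>
    ('g list \<Rightarrow> 'k::field) \<Rightarrow> 'g list \<Rightarrow> 'k" where
  "hecke_cochain_map G \<Gamma> R i \<psi> = (\<lambda>gs. if gs \<in> tuples (G\<lparr>carrier := \<Gamma>\<rparr>) i
     then \<Sum>\<alpha>\<in>R. \<psi> (map (hecke_xi G \<Gamma> R \<alpha>) gs) else 0)"

definition hecke_operator :: "('g, 'b) monoid_scheme \<Rightarrow> 'g set \<Rightarrow> 'g set \<Rightarrow> nat \<Rightarrow>
    ('g list \<Rightarrow> 'k::field) set \<Rightarrow> ('g list \<Rightarrow> 'k) set" where
  "hecke_operator G \<Gamma> R i = cohomology_map (G\<lparr>carrier := \<Gamma>\<rparr>) i (hecke_cochain_map G \<Gamma> R i)"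

section \<open>Upper triangular groups\<close>

text \<open>
  The field \<open>F\<^sub>q\<close> is a type \<open>'k\<close> of classes \<open>finite\<close> and \<open>field\<close> with \<open>q = CARD('k)\<close>; it is both the
  field of matrix entries and the trivial coefficient module.
\<close>

definition GL :: "nat \<Rightarrow> 'k::field mat monoid" where
  "GL n = units_of (ring_mat TYPE('k) n ())"

definition borel :: "nat \<Rightarrow> 'k::field mat set" where
  "borel n = {A \<in> carrier (GL n). upper_triangular A}"

definition borel_group :: "nat \<Rightarrow> 'k::field mat monoid" where
  "borel_group n = (GL n)\<lparr>carrier := borel n\<rparr>"

definition borel_cohomology ::
  "nat \<Rightarrow> nat \<Rightarrow> ('k::{finite,field}, ('k mat list \<Rightarrow> 'k) set) module" where
  "borel_cohomology i n = cohomology (borel_group n) i"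

text \<open>Matrix indices start at \<open>0\<close> in the library, so rows \<open>j\<close> and \<open>j + 1\<close> are \<open>j - 1\<close> and \<open>j\<close> there.\<close>

definition swap_matrix :: "nat \<Rightarrow> nat \<Rightarrow> 'k::field mat" where
  "swap_matrix n j = swaprows_mat n (j - 1) j"

definition restrict_mat :: "nat \<Rightarrow> 'k mat \<Rightarrow> 'k mat" where
  "restrict_mat n A = mat n n (\<lambda>(a, b). A $$ (a, b))"

definition Phi :: "nat \<Rightarrow> nat \<Rightarrow> ('k::{finite,field} mat list \<Rightarrow> 'k) set \<Rightarrow> ('k mat list \<Rightarrow> 'k) set"
  (\<open>\<Phi>\<close>) where
  "\<Phi> i n = cohomology_map (borel_group (n + 1)) i
     (pullback (borel_group (n + 1)) i (restrict_mat n))"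

end

theory Submission
  imports Defs
begin

text \<open>
  Write \<open>B\<^sub>n\<close> for the Borel subgroup of \<open>GL\<^sub>n\<close>.  For a \<open>B\<^sub>n\<close>-stable subset \<open>X\<close> of \<open>GL\<^sub>n\<close>, the complex of left
  \<open>B\<^sub>n\<close>-invariant functions on tuples of elements of \<open>X\<close> computes \<open>H(B\<^sub>n)\<close>: any two equivariant maps induce
  homotopic maps of complexes, so a \<open>B\<^sub>n\<close>-equivariant map \<open>GL\<^sub>n \<rightarrow> B\<^sub>n\<close> gives a homotopy inverse of the
  restriction to tuples in \<open>B\<^sub>n\<close>.  The gain of taking \<open>X = GL\<^sub>n\<close> is that the Hecke operator becomes
  \<open>\<phi>(g\<^sub>0, \<dots>, g\<^sub>i) \<mapsto> \<Sum>\<^sub>\<alpha> \<phi>(\<alpha> g\<^sub>0, \<dots>, \<alpha> g\<^sub>i)\<close>, which does not depend on the representatives \<open>\<alpha>\<close>, and the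
  relations \<open>T\<^sub>j\<^sup>2 = - T\<^sub>j\<close> and the braid relations hold for functions, not just for classes; they are
  row operations, with \<open>q = 0\<close> in the field.

  The inflation of a class from \<open>B\<^sub>n\<close> to \<open>B\<^sub>m\<close> does not extend to \<open>GL\<^sub>m\<close>, but it extends to the block parabolic
  subgroup, which contains the representatives \<open>\<alpha>\<close> for all \<open>j \<noteq> n\<close>.  There they act through the quotient
  \<open>GL\<^sub>n\<close>: as the corresponding representatives if \<open>j < n\<close>, and trivially if \<open>j > n\<close>, in which case the
  operator is multiplication by \<open>q = 0\<close>.
\<close>

section \<open>Invariant functions on tuples\<close>

text \<open>Splitting off the first entry turns identities for the alternating differential into
  list inductions: one face omits \<open>x\<close>, the others keep it, which shifts their signs.
  The function lives on lists of all lengths, so no degree has to be carried along.\<close>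

fun delta :: "('x list \<Rightarrow> 'k::ab_group_add) \<Rightarrow> 'x list \<Rightarrow> 'k" where
  "delta \<phi> [] = 0"
| "delta \<phi> (x # xs) = \<phi> xs - delta (\<lambda>ys. \<phi> (x # ys)) xs"

lemma delta_eq_sum:
  fixes \<phi> :: "'x list \<Rightarrow> 'k::comm_ring_1"
  shows "delta \<phi> xs = (\<Sum>j<length xs. (- 1) ^ j * \<phi> (take j xs @ drop (j + 1) xs))"
proof (induction xs arbitrary: \<phi>)
  case (Cons x xs)
  show ?case
    by (simp add: Cons.IH sum.lessThan_Suc_shift sum_negf del: sum.lessThan_Suc)
qed simp

lemma delta_cong:
  assumes "\<And>ys. Suc (length ys) = length xs \<Longrightarrow> set ys \<subseteq> set xs \<Longrightarrow> \<phi> ys = \<psi> ys"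
  shows "delta \<phi> xs = delta \<psi> xs"
  using assms
proof (induction xs arbitrary: \<phi> \<psi>)
  case (Cons x xs)
  have "delta (\<lambda>ys. \<phi> (x # ys)) xs = delta (\<lambda>ys. \<psi> (x # ys)) xs"
    by (rule Cons.IH) (auto intro!: Cons.prems)
  moreover have "\<phi> xs = \<psi> xs"
    by (auto intro!: Cons.prems)
  ultimately show ?case by simp
qed simp

lemma delta_diff: "delta (\<lambda>ys. \<phi> ys - \<psi> ys) xs = delta \<phi> xs - delta \<psi> xs"
  by (induction xs arbitrary: \<phi> \<psi>) simp_all

lemma delta_zero: "delta (\<lambda>ys. 0) xs = 0"
  by (induction xs) simp_all

lemma delta_add: "delta (\<lambda>ys. \<phi> ys + \<psi> ys) xs = delta \<phi> xs + delta \<psi> xs"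
  by (induction xs arbitrary: \<phi> \<psi>) simp_all

lemma delta_scale:
  fixes a :: "'k::comm_ring_1"
  shows "delta (\<lambda>ys. a * \<phi> ys) xs = a * delta \<phi> xs"
  by (induction xs arbitrary: \<phi>) (simp_all add: algebra_simps)

lemma delta_sum: "delta (\<lambda>ys. \<Sum>t\<in>S. \<phi> t ys) xs = (\<Sum>t\<in>S. delta (\<phi> t) xs)"
  by (induction xs arbitrary: \<phi>) (simp_all add: sum_subtractf)

lemma delta_map: "delta (\<lambda>ys. \<phi> (map f ys)) xs = delta \<phi> (map f xs)"
  by (induction xs arbitrary: \<phi>) simp_all

text \<open>The term \<open>delta \<phi> xs\<close> arises twice with opposite signs, from omitting
  \<open>x\<close> in the outer and in the inner differential. What remains is the claim for
  \<open>\<lambda>ys. \<phi> (x # ys)\<close>, hence the induction over arbitrary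
  \<open>\<phi>\<close>.\<close>

lemma delta_delta: "delta (delta \<phi>) xs = 0"
proof (induction xs arbitrary: \<phi>)
  case (Cons x xs)
  then show ?case by (simp add: delta_diff)
qed simp

text \<open>This is the prism operator of simplicial homotopy: unfolded, the sum over j of (-1)^j
  times the value of \<open>\<phi>\<close> at (f x_0, ..., f x_j, g x_j, ..., g x_r).\<close>

fun prism :: "('x \<Rightarrow> 'y) \<Rightarrow> ('x \<Rightarrow> 'y) \<Rightarrow> ('y list \<Rightarrow> 'k::ab_group_add) \<Rightarrow> 'x list \<Rightarrow> 'k" where
  "prism f g \<phi> [] = 0"
| "prism f g \<phi> (x # xs) = \<phi> (f x # g x # map g xs) - prism f g (\<lambda>ys. \<phi> (f x # ys)) xs"

lemma prism_diff: "prism f g (\<lambda>ys. \<phi> ys - \<psi> ys) xs = prism f g \<phi> xs - prism f g \<psi> xs"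
  by (induction xs arbitrary: \<phi> \<psi>) simp_all

lemma prism_zero:
  assumes "\<And>ys. length ys = Suc (length xs) \<Longrightarrow> set ys \<subseteq> f ` set xs \<union> g ` set xs \<Longrightarrow> \<phi> ys = 0"
  shows "prism f g \<phi> xs = 0"
  using assms
proof (induction xs arbitrary: \<phi>)
  case (Cons x xs)
  have "\<phi> (f x # g x # map g xs) = 0"
    by (rule Cons.prems) auto
  moreover have "prism f g (\<lambda>ys. \<phi> (f x # ys)) xs = 0"
    by (rule Cons.IH) (auto intro!: Cons.prems)
  ultimately show ?case by simp
qed simp

text \<open>With \<open>a\<close> and \<open>b\<close> the actions of corresponding group elements
  on source and target, this gives the invariance of the prism of an invariant function.\<close>

lemma prism_map:
  assumes "\<And>ys. set ys \<subseteq> f ` set xs \<union> g ` set xs \<Longrightarrow> \<phi> (map b ys) = \<phi> ys"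
    and "\<And>x. x \<in> set xs \<Longrightarrow> f (a x) = b (f x) \<and> g (a x) = b (g x)"
  shows "prism f g \<phi> (map a xs) = prism f g \<phi> xs"
proof -
  have "prism f g \<phi> (map a xs) = prism f g (\<lambda>ys. \<phi> (map b ys)) xs"
    using assms(2)
  proof (induction xs arbitrary: \<phi>)
    case (Cons x xs)
    have "prism f g (\<lambda>ys. \<phi> (f (a x) # ys)) (map a xs) = prism f g (\<lambda>ys. \<phi> (f (a x) # map b ys)) xs"
      using Cons.prems by (intro Cons.IH) auto
    moreover have "map g (map a xs) = map b (map g xs)"
      using Cons.prems by auto
    ultimately show ?case
      using Cons.prems by (simp del: map_map)
  qed simp
  also have "\<dots> = prism f g \<phi> xs"
  proof -
    \<comment> \<open>By linearity, the invariance of \<open>\<phi>\<close>, known only on lists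
      from the two images, becomes the vanishing of a difference there.\<close>
    have "prism f g (\<lambda>ys. \<phi> (map b ys) - \<phi> ys) xs = 0"
      by (rule prism_zero) (simp add: assms(1))
    then show ?thesis by (simp add: prism_diff)
  qed
  finally show ?thesis .
qed

text \<open>The homotopy formula dP + Pd = g* - f*. In the inductive step the two terms
  \<open>prism f g \<phi> xs\<close> cancel, as do the two differentials of \<open>\<phi>\<close>
  with both \<open>f x\<close> and \<open>g x\<close> in front; the rest is the induction hypothesis
  for \<open>\<phi>\<close> with \<open>f x\<close> in front.\<close>

lemma prism_homotopy:
  "delta (\<lambda>ys. prism f g \<phi> ys) xs + prism f g (delta \<phi>) xs = \<phi> (map g xs) - \<phi> (map f xs)"
proof (induction xs arbitrary: \<phi>)
  case (Cons x xs)
  let ?\<phi>' = "\<lambda>ys. \<phi> (f x # ys)"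
  have 1: "delta (\<lambda>ys. prism f g \<phi> ys) (x # xs) =
      prism f g \<phi> xs - delta (\<lambda>ys. \<phi> (f x # g x # ys)) (map g xs) + delta (\<lambda>ys. prism f g ?\<phi>' ys) xs"
    using delta_map[of "\<lambda>ys. \<phi> (f x # g x # ys)" g xs] by (simp add: delta_diff)
  have 2: "prism f g (delta \<phi>) (x # xs) = \<phi> (g x # map g xs) - ?\<phi>' (map g xs)
      + delta (\<lambda>ys. \<phi> (f x # g x # ys)) (map g xs) - prism f g \<phi> xs + prism f g (delta ?\<phi>') xs"
    by (simp add: prism_diff)
  show ?case
    unfolding 1 2 using Cons.IH[of ?\<phi>'] by (simp add: algebra_simps)
qed simp

section \<open>Invariant cochains and the relation of being cohomologous\<close>

definition tup :: "'x set \<Rightarrow> nat \<Rightarrow> 'x list set" where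
  "tup X i = {xs. length xs = i + 1 \<and> set xs \<subseteq> X}"

text \<open>Invariance is imposed on lists of all lengths at once, so that cochains, primitives and
  homotopies share one predicate without a degree.\<close>

definition invar :: "'g::times set \<Rightarrow> 'g set \<Rightarrow> ('g list \<Rightarrow> 'k) \<Rightarrow> bool" where
  "invar \<Gamma> X \<phi> \<longleftrightarrow> (\<forall>\<gamma>\<in>\<Gamma>. \<forall>xs\<in>lists X. \<phi> (map ((*) \<gamma>) xs) = \<phi> xs)"

definition closed_cochain :: "'g set \<Rightarrow> nat \<Rightarrow> ('g list \<Rightarrow> 'k::ab_group_add) \<Rightarrow> bool" where
  "closed_cochain X i \<phi> \<longleftrightarrow> (\<forall>xs\<in>tup X (i + 1). delta \<phi> xs = 0)"

text \<open>
  The condition \<open>\<eta> [] = 0\<close> makes degree \<open>0\<close> uniform with the others: as \<open>delta \<eta> [x] = \<eta> []\<close>, functions on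
  \<open>1\<close>-tuples are then cohomologous only if they are equal.
\<close>

definition cohom ::
  "'g::times set \<Rightarrow> 'g set \<Rightarrow> nat \<Rightarrow> ('g list \<Rightarrow> 'k::ab_group_add) \<Rightarrow> ('g list \<Rightarrow> 'k) \<Rightarrow> bool" where
  "cohom \<Gamma> X i \<phi> \<psi> \<longleftrightarrow>
    (\<exists>\<eta>. invar \<Gamma> X \<eta> \<and> \<eta> [] = 0 \<and> (\<forall>xs\<in>tup X i. \<phi> xs - \<psi> xs = delta \<eta> xs))"

lemma cohom_eq: "(\<And>xs. xs \<in> tup X i \<Longrightarrow> \<phi> xs = \<psi> xs) \<Longrightarrow> cohom \<Gamma> X i \<phi> \<psi>"
  unfolding cohom_def by (rule exI[of _ "\<lambda>_. 0"]) (auto simp: invar_def delta_zero)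

lemma cohom_refl: "cohom \<Gamma> X i \<phi> \<phi>"
  by (rule cohom_eq) simp

lemma cohom_add:
  assumes "cohom \<Gamma> X i \<phi> \<psi>" "cohom \<Gamma> X i \<phi>' \<psi>'"
  shows "cohom \<Gamma> X i (\<lambda>xs. \<phi> xs + \<phi>' xs) (\<lambda>xs. \<psi> xs + \<psi>' xs)"
proof -
  from assms obtain \<eta> \<eta>' where "invar \<Gamma> X \<eta>" "\<eta> [] = 0" "\<forall>xs\<in>tup X i. \<phi> xs - \<psi> xs = delta \<eta> xs"
    "invar \<Gamma> X \<eta>'" "\<eta>' [] = 0" "\<forall>xs\<in>tup X i. \<phi>' xs - \<psi>' xs = delta \<eta>' xs"
    unfolding cohom_def by blast
  then show ?thesis
    unfolding cohom_def
    by (intro exI[of _ "\<lambda>xs. \<eta> xs + \<eta>' xs"])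
       (auto simp: invar_def delta_add algebra_simps add_diff_add[symmetric])
qed

lemma cohom_scale:
  fixes a :: "'k::comm_ring_1"
  assumes "cohom \<Gamma> X i \<phi> \<psi>"
  shows "cohom \<Gamma> X i (\<lambda>xs. a * \<phi> xs) (\<lambda>xs. a * \<psi> xs)"
proof -
  from assms obtain \<eta> where "invar \<Gamma> X \<eta>" "\<eta> [] = 0" "\<forall>xs\<in>tup X i. \<phi> xs - \<psi> xs = delta \<eta> xs"
    unfolding cohom_def by blast
  then show ?thesis
    unfolding cohom_def
    by (intro exI[of _ "\<lambda>xs. a * \<eta> xs"]) (auto simp: invar_def delta_scale right_diff_distrib[symmetric])
qed

lemma cohom_sym:
  assumes "cohom \<Gamma> X i \<phi> \<psi>"
  shows "cohom \<Gamma> X i \<psi> \<phi>"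
proof -
  from assms obtain \<eta> where inv: "invar \<Gamma> X \<eta>" "\<eta> [] = 0"
    and d: "\<And>xs. xs \<in> tup X i \<Longrightarrow> delta \<eta> xs = \<phi> xs - \<psi> xs"
    unfolding cohom_def by metis
  show ?thesis
    unfolding cohom_def using inv
    by (intro exI[of _ "\<lambda>xs. 0 - \<eta> xs"]) (auto simp: invar_def delta_diff delta_zero d simp del: diff_0)
qed

lemma cohom_trans [trans]:
  assumes "cohom \<Gamma> X i \<phi> \<psi>" "cohom \<Gamma> X i \<psi> \<theta>"
  shows "cohom \<Gamma> X i \<phi> \<theta>"
proof -
  from assms obtain \<eta> \<eta>' where inv: "invar \<Gamma> X \<eta>" "\<eta> [] = 0" "invar \<Gamma> X \<eta>'" "\<eta>' [] = 0"
    and d: "\<And>xs. xs \<in> tup X i \<Longrightarrow> delta \<eta> xs = \<phi> xs - \<psi> xs"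
    and d': "\<And>xs. xs \<in> tup X i \<Longrightarrow> delta \<eta>' xs = \<psi> xs - \<theta> xs"
    unfolding cohom_def by metis
  show ?thesis
    unfolding cohom_def using inv
    by (intro exI[of _ "\<lambda>xs. \<eta> xs + \<eta>' xs"]) (auto simp: invar_def delta_add d d')
qed

section \<open>Restriction to subsets and pullback along equivariant maps\<close>

lemma tup_mono: "X \<subseteq> Y \<Longrightarrow> xs \<in> tup X i \<Longrightarrow> xs \<in> tup Y i"
  by (auto simp: tup_def)

lemma invar_mono: "invar \<Gamma> X \<phi> \<Longrightarrow> Y \<subseteq> X \<Longrightarrow> invar \<Gamma> Y \<phi>"
  unfolding invar_def using lists_mono by blast

lemma closed_cochain_mono: "closed_cochain X i \<phi> \<Longrightarrow> Y \<subseteq> X \<Longrightarrow> closed_cochain Y i \<phi>"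
  unfolding closed_cochain_def using tup_mono by blast

lemma cohom_mono: "cohom \<Gamma> X i \<phi> \<psi> \<Longrightarrow> Y \<subseteq> X \<Longrightarrow> cohom \<Gamma> Y i \<phi> \<psi>"
  unfolding cohom_def using invar_mono tup_mono by metis

lemma map_tup: "f ` X \<subseteq> Y \<Longrightarrow> xs \<in> tup X i \<Longrightarrow> map f xs \<in> tup Y i"
  by (auto simp: tup_def)

text \<open>The map \<open>r\<close> of acting groups is part of the data, because passing to the
  leading block of a matrix changes the group; \<open>r = id\<close> is ordinary
  equivariance.\<close>

definition equivariant :: "'g::times set \<Rightarrow> 'g set \<Rightarrow> 'h::times set \<Rightarrow> 'h set \<Rightarrow> ('g \<Rightarrow> 'h) \<Rightarrow> ('g \<Rightarrow> 'h) \<Rightarrow> bool"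
  where "equivariant \<Gamma> X \<Delta> Y r f \<longleftrightarrow> r ` \<Gamma> \<subseteq> \<Delta> \<and> f ` X \<subseteq> Y \<and> (\<forall>\<gamma>\<in>\<Gamma>. \<forall>x\<in>X. f (\<gamma> * x) = r \<gamma> * f x)"

lemma equivariant_mono:
  "equivariant \<Gamma> X \<Delta> Y r f \<Longrightarrow> X' \<subseteq> X \<Longrightarrow> Y \<subseteq> Y' \<Longrightarrow> equivariant \<Gamma> X' \<Delta> Y' r f"
  unfolding equivariant_def by blast

lemma equivariant_comp:
  assumes "equivariant \<Gamma> X \<Delta> Y r f" "equivariant \<Delta> Y \<Theta> Z s g"
  shows "equivariant \<Gamma> X \<Theta> Z (s \<circ> r) (g \<circ> f)"
  using assms unfolding equivariant_def by (simp add: image_subset_iff)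

lemma invar_pullback:
  assumes "invar \<Delta> Y \<phi>" "equivariant \<Gamma> X \<Delta> Y r f"
  shows "invar \<Gamma> X (\<lambda>xs. \<phi> (map f xs))"
  unfolding invar_def
proof (intro ballI)
  fix \<gamma> xs assume *: "\<gamma> \<in> \<Gamma>" "xs \<in> lists X"
  then have "map f (map ((*) \<gamma>) xs) = map ((*) (r \<gamma>)) (map f xs)"
    using assms(2) unfolding equivariant_def by auto
  moreover have "r \<gamma> \<in> \<Delta>" "map f xs \<in> lists Y"
    using assms(2) * unfolding equivariant_def by (auto simp: image_subset_iff)
  ultimately show "\<phi> (map f (map ((*) \<gamma>) xs)) = \<phi> (map f xs)"
    using assms(1) unfolding invar_def by (simp del: map_map)
qed

lemma closed_pullback:
  assumes "closed_cochain Y i \<phi>" "f ` X \<subseteq> Y"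
  shows "closed_cochain X i (\<lambda>xs. \<phi> (map f xs))"
  using assms map_tup[of f X Y] unfolding closed_cochain_def delta_map by blast

lemma cohom_pullback:
  assumes "cohom \<Delta> Y i \<phi> \<psi>" "equivariant \<Gamma> X \<Delta> Y r f"
  shows "cohom \<Gamma> X i (\<lambda>xs. \<phi> (map f xs)) (\<lambda>xs. \<psi> (map f xs))"
proof -
  from assms(1) obtain \<eta> where "invar \<Delta> Y \<eta>" "\<eta> [] = 0" "\<forall>xs\<in>tup Y i. \<phi> xs - \<psi> xs = delta \<eta> xs"
    unfolding cohom_def by blast
  then show ?thesis
    unfolding cohom_def using invar_pullback[OF _ assms(2)] map_tup[of f X Y] assms(2)
    by (intro exI[of _ "\<lambda>xs. \<eta> (map f xs)"]) (auto simp: delta_map equivariant_def)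
qed

text \<open>The primitive is \<open>prism f g \<phi>\<close>: it is invariant because
  \<open>f\<close> and \<open>g\<close> are equivariant along the same \<open>r\<close>, and the
  second term of the homotopy formula vanishes because \<open>\<phi>\<close> is closed. Comparisons
  between the models on Borel subgroup, block parabolic and full linear group rest on this.\<close>

lemma cohom_homotopy:
  assumes "invar \<Delta> Y \<phi>" "closed_cochain Y i \<phi>"
    and f: "equivariant \<Gamma> X \<Delta> Y r f" and g: "equivariant \<Gamma> X \<Delta> Y r g"
  shows "cohom \<Gamma> X i (\<lambda>xs. \<phi> (map g xs)) (\<lambda>xs. \<phi> (map f xs))"
  unfolding cohom_def
proof (intro exI[of _ "\<lambda>xs. prism f g \<phi> xs"] conjI ballI)
  have image: "set ys \<subseteq> Y" if "set ys \<subseteq> f ` set xs \<union> g ` set xs" "set xs \<subseteq> X" for xs ys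
  proof -
    have "f ` set xs \<subseteq> Y" "g ` set xs \<subseteq> Y"
      using that(2) f g unfolding equivariant_def by (meson image_mono order_trans)+
    with that(1) show ?thesis by blast
  qed
  show "invar \<Gamma> X (\<lambda>xs. prism f g \<phi> xs)"
    unfolding invar_def
  proof (intro ballI)
    fix \<gamma> xs assume *: "\<gamma> \<in> \<Gamma>" "xs \<in> lists X"
    show "prism f g \<phi> (map ((*) \<gamma>) xs) = prism f g \<phi> xs"
    proof (rule prism_map[where b = "(*) (r \<gamma>)"])
      fix ys assume "set ys \<subseteq> f ` set xs \<union> g ` set xs"
      then have "set ys \<subseteq> Y"
        using * by (intro image) auto
      moreover have "r \<gamma> \<in> \<Delta>"
        using * f by (auto simp: equivariant_def image_subset_iff)
      ultimately show "\<phi> (map ((*) (r \<gamma>)) ys) = \<phi> ys"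
        using assms(1) by (auto simp: invar_def in_lists_conv_set)
    next
      fix x assume "x \<in> set xs"
      with * have "x \<in> X" by auto
      with * f g show "f (\<gamma> * x) = r \<gamma> * f x \<and> g (\<gamma> * x) = r \<gamma> * g x"
        unfolding equivariant_def by blast
    qed
  qed
  fix xs assume xs: "xs \<in> tup X i"
  have "prism f g (delta \<phi>) xs = 0"
  proof (rule prism_zero)
    fix ys assume "length ys = Suc (length xs)" "set ys \<subseteq> f ` set xs \<union> g ` set xs"
    then have "ys \<in> tup Y (i + 1)"
      using xs image[of ys xs] by (simp add: tup_def)
    then show "delta \<phi> ys = 0"
      using assms(2) by (simp add: closed_cochain_def)
  qed
  then show "\<phi> (map g xs) - \<phi> (map f xs) = delta (\<lambda>xs. prism f g \<phi> xs) xs"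
    using prism_homotopy[of f g \<phi> xs] by simp
qed simp

section \<open>Matrix groups\<close>

text \<open>Left multiplication by an element of a finite closed set is injective, hence onto, which
  yields the unit and inverses. Over a finite field this avoids computing inverses of triangular and
  block triangular matrices.\<close>

lemma (in group) finite_closed_imp_subgroup:
  assumes "finite S" "S \<noteq> {}" "S \<subseteq> carrier G" "\<And>x y. x \<in> S \<Longrightarrow> y \<in> S \<Longrightarrow> x \<otimes> y \<in> S"
  shows "subgroup S G"
proof -
  have surj: "(\<otimes>) a ` S = S" if "a \<in> S" for a
  proof (rule endo_inj_surj[OF assms(1)])
    show "inj_on ((\<otimes>) a) S"
      using that assms(3) by (intro inj_onI) (auto simp: subset_iff)
  qed (use that assms in auto)
  have one: "\<one> \<in> S"
  proof -
    from assms(2) obtain a where a: "a \<in> S" by blast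
    with surj[OF a] obtain e where "e \<in> S" "a = a \<otimes> e" by blast
    moreover have "a \<in> carrier G" "e \<in> carrier G"
      using a \<open>e \<in> S\<close> assms(3) by auto
    ultimately show ?thesis
      using l_cancel_one'[of a e] by simp
  qed
  have "inv a \<in> S" if a: "a \<in> S" for a
  proof -
    from surj[OF a] one obtain b where b: "b \<in> S" "a \<otimes> b = \<one>" by (metis imageE)
    have carr: "a \<in> carrier G" "b \<in> carrier G"
      using a b assms(3) by auto
    then have "inv b = a"
      using b by (intro inv_equality)
    with carr b show ?thesis by auto
  qed
  with assms one show ?thesis by (intro subgroupI) auto
qed

lemma finite_carrier_mat: "finite (carrier_mat n m :: 'a::finite mat set)"
proof (rule finite_surj)
  show "finite ({0..<n} \<times> {0..<m} \<rightarrow>\<^sub>E (UNIV :: 'a set))"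
    by (intro finite_PiE) auto
  show "carrier_mat n m \<subseteq> mat n m ` ({0..<n} \<times> {0..<m} \<rightarrow>\<^sub>E (UNIV :: 'a set))"
  proof
    fix A :: "'a mat" assume A: "A \<in> carrier_mat n m"
    show "A \<in> mat n m ` ({0..<n} \<times> {0..<m} \<rightarrow>\<^sub>E UNIV)"
      by (rule image_eqI[of _ _ "restrict (($$) A) ({0..<n} \<times> {0..<m})"]) (use A in auto)
  qed
qed

section \<open>General linear groups and Borel subgroups\<close>

lemma GL_carrier: "A \<in> carrier (GL n) \<longleftrightarrow>
    A \<in> carrier_mat n n \<and> (\<exists>B\<in>carrier_mat n n. B * A = 1\<^sub>m n \<and> A * B = 1\<^sub>m n)"
  by (simp add: GL_def units_of_def Units_def ring_mat_def)

lemma GL_carrier_mat: "A \<in> carrier (GL n) \<Longrightarrow> A \<in> carrier_mat n n"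
  by (simp add: GL_carrier)

lemma GL_mult: "mult (GL n) = (*)" and GL_one: "one (GL n) = 1\<^sub>m n"
  by (simp_all add: GL_def units_of_def ring_mat_def)

lemma group_GL: "group (GL n :: 'k::field mat monoid)"
proof -
  interpret ring "ring_mat TYPE('k) n ()" by (rule ring_mat)
  show ?thesis unfolding GL_def by (rule units_group)
qed

lemma finite_GL: "finite (carrier (GL n :: 'k::{finite,field} mat monoid))"
  by (rule finite_subset[OF _ finite_carrier_mat[of n n]]) (auto simp: GL_carrier)

lemma GL_mult_closed: "A \<in> carrier (GL n) \<Longrightarrow> B \<in> carrier (GL n) \<Longrightarrow> A * B \<in> carrier (GL n)"
  using monoid.m_closed[OF group.is_monoid[OF group_GL], of A n B] by (simp add: GL_mult)

lemma GL_mult_assoc: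
  "\<lbrakk>A \<in> carrier (GL n); B \<in> carrier (GL n); C \<in> carrier (GL n)\<rbrakk> \<Longrightarrow> A * B * C = A * (B * C)"
  by (rule assoc_mult_mat) (auto intro: GL_carrier_mat)

lemma one_in_GL: "1\<^sub>m n \<in> carrier (GL n)"
  by (auto simp: GL_carrier)

lemma borel_subset_GL: "borel n \<subseteq> carrier (GL n)"
  by (auto simp: borel_def)

lemma borel_carrier_mat: "A \<in> borel n \<Longrightarrow> A \<in> carrier_mat n n"
  by (auto simp: borel_def GL_carrier)

lemma mult_mat_entry:
  "\<lbrakk>A \<in> carrier_mat n k; B \<in> carrier_mat k m; x < n; y < m\<rbrakk> \<Longrightarrow>
    (A * B) $$ (x, y) = (\<Sum>l<k. A $$ (x, l) * B $$ (l, y))"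
  by (simp add: scalar_prod_def atLeast0LessThan)

lemma borel_mult_closed:
  assumes "A \<in> borel n" "B \<in> borel n"
  shows "A * B \<in> borel n"
proof -
  have A: "A \<in> carrier_mat n n" and B: "B \<in> carrier_mat n n"
    using assms by (auto simp: borel_carrier_mat)
  have "upper_triangular (A * B)"
  proof (rule upper_triangularI)
    fix x y assume "y < x" "x < dim_row (A * B)"
    then have xy: "y < x" "x < n" using A by auto
    have "A $$ (x, l) * B $$ (l, y) = 0" if "l < n" for l
    proof (cases "l < x")
      case True
      then show ?thesis
        using assms(1) A xy by (simp add: borel_def upper_triangularD)
    next
      case False
      then show ?thesis
        using assms(2) B xy that by (simp add: borel_def upper_triangularD)
    qed
    then show "(A * B) $$ (x, y) = 0"
      using xy by (simp add: mult_mat_entry[OF A B] del: mult_eq_0_iff)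
  qed
  then show ?thesis
    using assms by (simp add: borel_def GL_mult_closed)
qed

lemma one_in_borel: "1\<^sub>m n \<in> borel n"
  by (simp add: borel_def one_in_GL)

lemma subgroup_borel: "subgroup (borel n :: 'k::{finite,field} mat set) (GL n)"
proof (rule group.finite_closed_imp_subgroup[OF group_GL])
  show "finite (borel n :: 'k mat set)"
    using finite_GL borel_subset_GL by (rule rev_finite_subset)
qed (use one_in_borel borel_subset_GL in \<open>auto simp: GL_mult borel_mult_closed\<close>)

lemma borel_group_simps:
  "carrier (borel_group n) = borel n" "mult (borel_group n) = (*)" "one (borel_group n) = 1\<^sub>m n"
  by (simp_all add: borel_group_def GL_mult GL_one)

text \<open>The determinant is the product of the diagonal entries. This justifies the divisions by
  diagonal entries in the coset computations.\<close>

lemma borel_diag_nonzero: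
  assumes "A \<in> borel n" "x < n"
  shows "A $$ (x, x) \<noteq> 0"
proof -
  have A: "A \<in> carrier_mat n n" and A': "upper_triangular A" and "A \<in> Units (ring_mat TYPE('a) n ())"
    using assms by (auto simp: borel_def GL_carrier_mat GL_def units_of_def)
  then have "det A \<noteq> 0"
    by (intro unit_imp_det_non_zero)
  then show ?thesis
    using det_upper_triangular[OF A' A] assms(2) A
    by (auto simp: diag_mat_def prod_list_zero_iff)
qed

section \<open>Matrices equal to the identity outside a two by two diagonal block\<close>

definition row_block :: "nat \<Rightarrow> nat \<Rightarrow> 'k \<Rightarrow> 'k \<Rightarrow> 'k \<Rightarrow> 'k \<Rightarrow> 'k::field mat" where
  "row_block m p a b c d = mat m m (\<lambda>(x, y).
     if x = p then (if y = p then a else if y = Suc p then b else 0)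
     else if x = Suc p then (if y = p then c else if y = Suc p then d else 0)
     else if x = y then 1 else 0)"

lemma row_block_carrier: "row_block m p a b c d \<in> carrier_mat m m"
  by (simp add: row_block_def)

lemma sum_two:
  fixes h :: "nat \<Rightarrow> 'k::field"
  assumes "Suc p < m"
  shows "(\<Sum>l<m. (if l = p then a else if l = Suc p then b else 0) * h l) = a * h p + b * h (Suc p)"
    and "(\<Sum>l<m. h l * (if l = p then a else if l = Suc p then b else 0)) = h p * a + h (Suc p) * b"
proof -
  have "(\<Sum>l<m. (if l = p then a else if l = Suc p then b else 0) * h l) =
      (\<Sum>l<m. (if l = p then a * h p else 0) + (if l = Suc p then b * h (Suc p) else 0))"
    by (rule sum.cong) auto
  then show *: "(\<Sum>l<m. (if l = p then a else if l = Suc p then b else 0) * h l) = a * h p + b * h (Suc p)"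
    using assms by (simp add: sum.distrib)
  then show "(\<Sum>l<m. h l * (if l = p then a else if l = Suc p then b else 0)) = h p * a + h (Suc p) * b"
    by (simp add: mult.commute)
qed

lemma row_block_mult:
  assumes "Suc p < m" "A \<in> carrier_mat m k"
  shows "row_block m p a b c d * A = mat m k (\<lambda>(x, y).
    if x = p then a * A $$ (p, y) + b * A $$ (Suc p, y)
    else if x = Suc p then c * A $$ (p, y) + d * A $$ (Suc p, y) else A $$ (x, y))"
    (is "?L = mat m k ?R")
proof (rule eq_matI)
  fix x y assume "x < dim_row (mat m k ?R)" "y < dim_col (mat m k ?R)"
  then have xy: "x < m" "y < k" by auto
  have "?L $$ (x, y) = (\<Sum>l<m. row_block m p a b c d $$ (x, l) * A $$ (l, y))"
    using xy by (rule mult_mat_entry[OF row_block_carrier assms(2)])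
  also have "\<dots> = ?R (x, y)"
  proof (cases "x = p \<or> x = Suc p")
    case True
    then show ?thesis
      using xy assms(1) by (auto simp: row_block_def sum_two[where h = "\<lambda>l. A $$ (l, y)"])
  next
    case False
    then have "(\<Sum>l<m. row_block m p a b c d $$ (x, l) * A $$ (l, y)) = (\<Sum>l<m. if l = x then A $$ (x, y) else 0)"
      using xy by (intro sum.cong) (auto simp: row_block_def)
    with False xy show ?thesis by simp
  qed
  finally show "?L $$ (x, y) = mat m k ?R $$ (x, y)" using xy by simp
qed (use assms(2) in \<open>auto simp: row_block_def\<close>)

lemma mult_row_block:
  assumes "Suc p < m" "A \<in> carrier_mat k m"
  shows "A * row_block m p a b c d = mat k m (\<lambda>(x, y).
    if y = p then A $$ (x, p) * a + A $$ (x, Suc p) * c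
    else if y = Suc p then A $$ (x, p) * b + A $$ (x, Suc p) * d else A $$ (x, y))"
    (is "?L = mat k m ?R")
proof (rule eq_matI)
  fix x y assume "x < dim_row (mat k m ?R)" "y < dim_col (mat k m ?R)"
  then have xy: "x < k" "y < m" by auto
  have "?L $$ (x, y) = (\<Sum>l<m. A $$ (x, l) * row_block m p a b c d $$ (l, y))"
    using xy by (rule mult_mat_entry[OF assms(2) row_block_carrier])
  also have "\<dots> = ?R (x, y)"
  proof (cases "y = p \<or> y = Suc p")
    case True
    define u v where "u = (if y = p then a else b)" and "v = (if y = p then c else d)"
    have "(\<Sum>l<m. A $$ (x, l) * row_block m p a b c d $$ (l, y)) =
        (\<Sum>l<m. A $$ (x, l) * (if l = p then u else if l = Suc p then v else 0))"
      using True xy by (intro sum.cong) (auto simp: row_block_def u_def v_def)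
    then show ?thesis
      using True xy assms(1) by (auto simp: sum_two[where h = "\<lambda>l. A $$ (x, l)"] u_def v_def)
  next
    case False
    then have "(\<Sum>l<m. A $$ (x, l) * row_block m p a b c d $$ (l, y)) = (\<Sum>l<m. if l = y then A $$ (x, y) else 0)"
      using xy by (intro sum.cong) (auto simp: row_block_def)
    with False xy show ?thesis by simp
  qed
  finally show "?L $$ (x, y) = mat k m ?R $$ (x, y)" using xy by simp
qed (use assms(2) in \<open>auto simp: row_block_def\<close>)

lemma row_block_mult_row_block:
  assumes "Suc p < m"
  shows "row_block m p a b c d * row_block m p a' b' c' d' =
    row_block m p (a * a' + b * c') (a * b' + b * d') (c * a' + d * c') (c * b' + d * d')"
  unfolding row_block_mult[OF assms row_block_carrier]
  using assms by (intro eq_matI) (auto simp: row_block_def)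

lemma row_block_one: "row_block m p 1 0 0 1 = 1\<^sub>m m"
  by (intro eq_matI) (auto simp: row_block_def)

lemma row_block_in_GL:
  assumes "Suc p < m" "a * d - b * c \<noteq> 0"
  shows "row_block m p a b c d \<in> carrier (GL m)"
proof -
  define e where "e = a * d - b * c"
  \<comment> \<open>The inverse is the adjugate of the block divided by its determinant
    \<open>e\<close>.\<close>
  let ?B = "row_block m p (d / e) (- b / e) (- c / e) (a / e)"
  have e: "e \<noteq> 0" using assms(2) by (simp add: e_def)
  have "a * d = e + b * c" by (simp add: e_def)
  then have eq: "a * (d / e) + b * (- c / e) = 1" "d / e * a + - b / e * c = 1"
     "- c / e * b + a / e * d = 1" "c * (- b / e) + d * (a / e) = 1"
    using e by (simp_all add: field_simps)
  have "row_block m p a b c d * ?B = 1\<^sub>m m" "?B * row_block m p a b c d = 1\<^sub>m m"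
    unfolding row_block_mult_row_block[OF assms(1)] eq row_block_one[symmetric, of m p]
    by (simp_all add: algebra_simps)
  then show ?thesis
    using row_block_carrier unfolding GL_carrier by blast
qed

text \<open>
  Left multiplication by \<open>sw m p t\<close> replaces the rows \<open>(x, y)\<close> with numbers \<open>p\<close> and \<open>p + 1\<close> (counted from
  \<open>0\<close>) by \<open>(y, x + t y)\<close>; the matrix is the product of \<open>E\<^bsub>p+1,p+2\<^esub>\<close> and an elementary matrix.
\<close>

definition sw :: "nat \<Rightarrow> nat \<Rightarrow> 'k \<Rightarrow> 'k::field mat" where
  "sw m p t = row_block m p 0 1 1 t"

lemma sw_in_GL: "Suc p < m \<Longrightarrow> sw m p t \<in> carrier (GL m)"
  unfolding sw_def by (rule row_block_in_GL) auto

text \<open>Generators are numbered from 1 and block positions \<open>p\<close> from 0; this is the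
  source of every \<open>j - 1\<close> below.\<close>

lemma swap_matrix_eq: "1 \<le> j \<Longrightarrow> j < n \<Longrightarrow> swap_matrix n j = sw n (j - 1) 0"
  by (intro eq_matI) (auto simp: swap_matrix_def swaprows_mat_def sw_def row_block_def)

lemma row_block_in_borel:
  assumes "Suc p < m" "a \<noteq> 0" "d \<noteq> 0"
  shows "row_block m p a b 0 d \<in> borel m"
  unfolding borel_def using assms
  by (auto intro!: row_block_in_GL upper_triangularI) (auto simp: row_block_def)

text \<open>A right factor from the Borel subgroup permutes the cosets of the
  \<open>sw m p t\<close> by an affine substitution in \<open>t\<close>. The new parameter is the
  ratio of the entries of \<open>sw m p t * g\<close> in row \<open>Suc p\<close> and columns
  \<open>Suc p\<close> and \<open>p\<close>.\<close>

lemma sw_mult_borel: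
  assumes p: "Suc p < m" and g: "g \<in> borel m"
  shows "\<exists>b\<in>borel m. sw m p t * g = b * sw m p ((g $$ (p, Suc p) + t * g $$ (Suc p, Suc p)) / g $$ (p, p))"
proof -
  define t' where "t' = (g $$ (p, Suc p) + t * g $$ (Suc p, Suc p)) / g $$ (p, p)"
  have gp: "g $$ (p, p) \<noteq> 0"
    using borel_diag_nonzero[OF g, of p] p by simp
  have gm: "g \<in> carrier_mat m m" and gG: "g \<in> carrier (GL m)"
    using g by (simp_all add: borel_carrier_mat borel_def)
  \<comment> \<open>This is the inverse of \<open>sw m p t'\<close>, so \<open>b\<close> is the only
    possible left factor.\<close>
  let ?r = "row_block m p (- t') 1 1 0"
  define b where "b = sw m p t * g * ?r"
  have rG: "?r \<in> carrier (GL m)"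
    using p by (rule row_block_in_GL) simp
  have bG: "b \<in> carrier (GL m)"
    unfolding b_def using p gG rG by (intro GL_mult_closed sw_in_GL)
  have up: "g $$ (x, y) = 0" if "y < x" "x < m" for x y
    using g gm that by (auto simp: borel_def)
  have "upper_triangular b"
  proof (rule upper_triangularI)
    fix x y assume "y < x" "x < dim_row b"
    then have xy: "y < x" "x < m" using bG by (auto simp: GL_carrier)
    \<comment> \<open>The choice of \<open>t'\<close> serves to keep the product upper triangular
      after the two columns are recombined; the other entries below the diagonal vanish because
      \<open>g\<close> is triangular.\<close>
    have "g $$ (p, p) * t' = g $$ (p, Suc p) + t * g $$ (Suc p, Suc p)"
      using gp by (simp add: t'_def)
    with xy p show "b $$ (x, y) = 0"
      unfolding b_def sw_def row_block_mult[OF p gm]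
      by (subst mult_row_block[OF p]) (auto simp: up mult.commute)
  qed
  then have "b \<in> borel m"
    using bG by (simp add: borel_def)
  moreover have "b * sw m p t' = sw m p t * g * (?r * sw m p t')"
    unfolding b_def by (intro GL_mult_assoc[of _ m] GL_mult_closed sw_in_GL p gG rG)
  moreover have "?r * sw m p t' = 1\<^sub>m m"
    unfolding sw_def row_block_mult_row_block[OF p] row_block_one[symmetric, of m p] by simp
  moreover have "sw m p t * g * 1\<^sub>m m = sw m p t * g"
    by (rule right_mult_one_mat[of _ m]) (use p gG in \<open>auto intro!: GL_carrier_mat GL_mult_closed sw_in_GL\<close>)
  ultimately show ?thesis unfolding t'_def by metis
qed

text \<open>In row \<open>Suc p\<close> the entry of \<open>b\<close> left of the diagonal is 0;
  column \<open>p\<close> then forces the diagonal entry to be 1, and column \<open>Suc p\<close>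
  gives the equality of parameters.\<close>

lemma sw_coset_unique:
  assumes p: "Suc p < m" and "b \<in> borel m" "sw m p t = b * sw m p t'"
  shows "t = t'"
proof -
  have b: "b \<in> carrier_mat m m" using assms(2) by (rule borel_carrier_mat)
  have "b $$ (Suc p, p) = 0"
    using assms(2) p b by (auto simp: borel_def)
  moreover have "sw m p t $$ (Suc p, y) = (b * sw m p t') $$ (Suc p, y)" for y
    using assms(3) by simp
  from this[of p] this[of "Suc p"]
  have "1 = b $$ (Suc p, Suc p)" "t = b $$ (Suc p, p) + b $$ (Suc p, Suc p) * t'"
    using p unfolding sw_def mult_row_block[OF p b] by (auto simp: row_block_def)
  ultimately show ?thesis by simp
qed

lemma sw_commute:
  assumes "Suc p < m" "Suc q < m" "Suc p < q \<or> Suc q < p" "g \<in> carrier_mat m k"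
  shows "sw m p a * (sw m q b * g) = sw m q b * (sw m p a * g)"
proof -
  have "mat m k f \<in> carrier_mat m k" for f :: "nat \<times> nat \<Rightarrow> 'a" by simp
  note row_block_mult[OF assms(1) this] row_block_mult[OF assms(2) this]
  then show ?thesis
    unfolding sw_def row_block_mult[OF assms(1,4)] row_block_mult[OF assms(2,4)]
    using assms(1-3) by (auto intro!: eq_matI)
qed

text \<open>Both sides turn the rows (x, y, z) into (z, y + c z, x + a y + b z). The middle
  parameter undergoes the shear \<open>b - a * c\<close>, a bijection in \<open>b\<close> for fixed
  \<open>a\<close> and \<open>c\<close>.\<close>

lemma sw_braid:
  assumes p: "Suc (Suc p) < m" and "g \<in> carrier_mat m k"
  shows "sw m p c * (sw m (Suc p) b * (sw m p a * g)) =
    sw m (Suc p) a * (sw m p (b - a * c) * (sw m (Suc p) c * g))"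
proof -
  have p': "Suc p < m" using p by simp
  have "mat m k f \<in> carrier_mat m k" for f :: "nat \<times> nat \<Rightarrow> 'a" by simp
  note row_block_mult[OF p this] row_block_mult[OF p' this]
  then show ?thesis
    unfolding sw_def row_block_mult[OF p assms(2)] row_block_mult[OF p' assms(2)]
    using p by (auto intro!: eq_matI simp: algebra_simps)
qed

lemma sw_sw_zero: "Suc p < m \<Longrightarrow> sw m p 0 * sw m p t = row_block m p 1 t 0 1"
  by (simp add: sw_def row_block_mult_row_block)

text \<open>Together with \<open>sw_sw_zero\<close> this is the explicit form of the decomposition
  of BsBsB into B and BsB: a left parameter 0 leads into the Borel subgroup, any other
  \<open>u\<close> back to a coset of some \<open>sw\<close>, with \<open>t\<close> translated by
  \<open>1 / u\<close>.\<close>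

lemma sw_sw_nonzero:
  assumes "Suc p < m" "u \<noteq> 0"
  shows "sw m p u * sw m p t = row_block m p (- 1 / u) 1 0 u * sw m p (t + 1 / u)"
  using assms by (simp add: sw_def row_block_mult_row_block distrib_left add.commute)

section \<open>Block parabolic subgroups and restriction to the leading block\<close>

definition block_parabolic :: "nat \<Rightarrow> nat \<Rightarrow> 'k::field mat set" where
  "block_parabolic n m = {A \<in> carrier (GL m). \<forall>x y. n \<le> x \<longrightarrow> x < m \<longrightarrow> y < n \<longrightarrow> A $$ (x, y) = 0}"

lemma block_parabolic_subset_GL: "block_parabolic n m \<subseteq> carrier (GL m)"
  by (auto simp: block_parabolic_def)

lemma borel_subset_block_parabolic: "borel m \<subseteq> block_parabolic n m"
  by (auto simp: block_parabolic_def borel_def GL_carrier)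

text \<open>The only excluded position is \<open>Suc p = n\<close>, where the two by two block
  straddles the border of the leading block.\<close>

lemma sw_in_block_parabolic:
  "Suc p < m \<Longrightarrow> Suc p < n \<or> n \<le> p \<Longrightarrow> sw m p t \<in> block_parabolic n m"
  by (auto simp: block_parabolic_def sw_in_GL) (auto simp: sw_def row_block_def)

text \<open>The summands with inner index at least \<open>n\<close> vanish because the lower left
  block of the right factor is zero.\<close>

lemma restrict_mat_mult:
  assumes "n \<le> m" "A \<in> carrier_mat m m" "B \<in> block_parabolic n m"
  shows "restrict_mat n (A * B) = restrict_mat n A * restrict_mat n B"
proof (rule eq_matI)
  have B: "B \<in> carrier_mat m m"
    using assms(3) by (auto simp: block_parabolic_def GL_carrier)
  have r: "restrict_mat n C \<in> carrier_mat n n" for C :: "'a mat"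
    by (simp add: restrict_mat_def)
  fix x y assume "x < dim_row (restrict_mat n A * restrict_mat n B)"
    "y < dim_col (restrict_mat n A * restrict_mat n B)"
  then have xy: "x < n" "y < n" by (simp_all add: restrict_mat_def)
  have "(A * B) $$ (x, y) = (\<Sum>l<m. A $$ (x, l) * B $$ (l, y))"
    using xy assms(1) by (intro mult_mat_entry[OF assms(2) B]) auto
  also have "\<dots> = (\<Sum>l<n. A $$ (x, l) * B $$ (l, y))"
    using assms(1,3) xy by (intro sum.mono_neutral_right) (auto simp: block_parabolic_def)
  also have "\<dots> = (restrict_mat n A * restrict_mat n B) $$ (x, y)"
    using xy by (subst mult_mat_entry[OF r r]) (auto simp: restrict_mat_def)
  finally show "restrict_mat n (A * B) $$ (x, y) = (restrict_mat n A * restrict_mat n B) $$ (x, y)"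
    using xy by (simp add: restrict_mat_def)
qed (simp_all add: restrict_mat_def)

lemma block_parabolic_mult_closed:
  assumes "A \<in> block_parabolic n m" "B \<in> block_parabolic n m"
  shows "A * B \<in> block_parabolic n m"
proof -
  have A: "A \<in> carrier_mat m m" and B: "B \<in> carrier_mat m m"
    using assms by (auto simp: block_parabolic_def GL_carrier)
  have "(A * B) $$ (x, y) = 0" if "n \<le> x" "x < m" "y < n" for x y
  proof -
    have "A $$ (x, l) * B $$ (l, y) = 0" if "l < m" for l
      using assms \<open>n \<le> x\<close> \<open>x < m\<close> \<open>y < n\<close> that by (cases "l < n") (auto simp: block_parabolic_def)
    then show ?thesis
      using that by (simp add: mult_mat_entry[OF A B] del: mult_eq_0_iff)
  qed
  then show ?thesis
    using assms by (simp add: block_parabolic_def GL_mult_closed)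
qed

lemma subgroup_block_parabolic:
  "subgroup (block_parabolic n m :: 'k::{finite,field} mat set) (GL m)"
proof (rule group.finite_closed_imp_subgroup[OF group_GL])
  show "finite (block_parabolic n m :: 'k mat set)"
    using finite_GL block_parabolic_subset_GL by (rule rev_finite_subset)
  show "block_parabolic n m \<noteq> ({} :: 'k mat set)"
    using one_in_borel borel_subset_block_parabolic by blast
qed (use block_parabolic_subset_GL in \<open>auto simp: GL_mult block_parabolic_mult_closed\<close>)

lemma restrict_mat_one: "n \<le> m \<Longrightarrow> restrict_mat n (1\<^sub>m m) = 1\<^sub>m n"
  by (intro eq_matI) (auto simp: restrict_mat_def)

text \<open>The inverse of \<open>A\<close> is again in the block parabolic subgroup, so its leading
  block inverts that of \<open>A\<close>.\<close>

lemma restrict_mat_in_GL: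
  fixes A :: "'k::{finite,field} mat"
  assumes "n \<le> m" "A \<in> block_parabolic n m"
  shows "restrict_mat n A \<in> carrier (GL n)"
proof -
  let ?B = "inv\<^bsub>GL m\<^esub> A"
  have B: "?B \<in> block_parabolic n m"
    using subgroup.m_inv_closed[OF subgroup_block_parabolic assms(2)] .
  have A: "A \<in> carrier (GL m)" using assms(2) block_parabolic_subset_GL by blast
  have "A * ?B = 1\<^sub>m m" "?B * A = 1\<^sub>m m"
    using group.r_inv[OF group_GL A] group.l_inv[OF group_GL A] by (simp_all add: GL_mult GL_one)
  moreover have "A \<in> carrier_mat m m" "?B \<in> carrier_mat m m"
    using A B block_parabolic_subset_GL GL_carrier_mat by blast+
  ultimately have "restrict_mat n A * restrict_mat n ?B = 1\<^sub>m n" "restrict_mat n ?B * restrict_mat n A = 1\<^sub>m n"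
    using restrict_mat_mult[OF assms(1) _ B, of A] restrict_mat_mult[OF assms(1) _ assms(2), of ?B]
    by (simp_all add: restrict_mat_one[OF assms(1)])
  moreover have "restrict_mat n A \<in> carrier_mat n n" "restrict_mat n ?B \<in> carrier_mat n n"
    by (simp_all add: restrict_mat_def)
  ultimately show ?thesis
    unfolding GL_carrier by blast
qed

lemma restrict_mat_in_borel:
  fixes A :: "'k::{finite,field} mat"
  assumes "n \<le> m" "A \<in> borel m"
  shows "restrict_mat n A \<in> borel n"
proof -
  have "restrict_mat n A \<in> carrier (GL n)"
    using assms borel_subset_block_parabolic by (blast intro: restrict_mat_in_GL)
  then show ?thesis
    using assms by (auto simp: borel_def restrict_mat_def GL_carrier upper_triangular_def)
qed

lemma restrict_mat_sw:
  "Suc p < n \<Longrightarrow> n \<le> m \<Longrightarrow> restrict_mat n (sw m p t) = sw n p t"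
  "n \<le> p \<Longrightarrow> n \<le> m \<Longrightarrow> restrict_mat n (sw m p t) = 1\<^sub>m n"
  by (intro eq_matI; auto simp: restrict_mat_def sw_def row_block_def)+

lemma restrict_mat_restrict_mat:
  "n \<le> m \<Longrightarrow> restrict_mat n (restrict_mat m A) = restrict_mat n A"
  by (intro eq_matI) (auto simp: restrict_mat_def)

section \<open>Coset representatives and equivariant retractions\<close>

text \<open>A left \<open>H\<close>-invariant function has one value on each coset
  \<open>H #> x\<close>, so the sum runs over the cosets in the double coset. The right-hand side
  does not mention \<open>R\<close>, which makes two systems of representatives
  interchangeable.\<close>

lemma (in group) sum_coset_reps:
  assumes H: "subgroup H G" and R: "coset_reps G H g R"
    and inv: "\<And>h x. h \<in> H \<Longrightarrow> x \<in> carrier G \<Longrightarrow> f (h \<otimes> x) = f x"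
  shows "sum f R = (\<Sum>C\<in>(#>) H ` double_coset G H g. f (SOME x. x \<in> C))"
proof -
  have sub: "R \<subseteq> carrier G" and dc: "double_coset G H g = (\<Union>\<alpha>\<in>R. H #> \<alpha>)"
    and disj: "disjoint_family_on (\<lambda>\<alpha>. H #> \<alpha>) R"
    using R by (auto simp: coset_reps_def)
  have inj: "inj_on ((#>) H) R"
  proof (rule inj_onI)
    fix \<alpha> \<beta> assume *: "\<alpha> \<in> R" "\<beta> \<in> R" "H #> \<alpha> = H #> \<beta>"
    then have "\<alpha> \<in> (H #> \<alpha>) \<inter> (H #> \<beta>)"
      using sub rcos_self[OF _ H] by auto
    then show "\<alpha> = \<beta>"
      using disj * by (auto simp: disjoint_family_on_def)
  qed
  have "(#>) H ` double_coset G H g = (#>) H ` R"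
    unfolding dc
  proof (intro equalityI subsetI)
    fix C assume "C \<in> (#>) H ` (\<Union>\<alpha>\<in>R. H #> \<alpha>)"
    then obtain \<alpha> x where "\<alpha> \<in> R" "x \<in> H #> \<alpha>" "C = H #> x" by blast
    then show "C \<in> (#>) H ` R"
      using repr_independence[OF _ _ H] sub by blast
  next
    fix C assume "C \<in> (#>) H ` R"
    then obtain \<alpha> where "\<alpha> \<in> R" "C = H #> \<alpha>" by blast
    then show "C \<in> (#>) H ` (\<Union>\<alpha>\<in>R. H #> \<alpha>)"
      using sub rcos_self[OF _ H] by blast
  qed
  moreover have "f (SOME x. x \<in> H #> \<alpha>) = f \<alpha>" if "\<alpha> \<in> R" for \<alpha>
  proof -
    have "\<alpha> \<in> carrier G"
      using that sub by blast
    then have "\<alpha> \<in> H #> \<alpha>"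
      by (rule rcos_self[OF _ H])
    then have "(SOME x. x \<in> H #> \<alpha>) \<in> H #> \<alpha>"
      by (rule someI)
    then obtain h where "h \<in> H" "(SOME x. x \<in> H #> \<alpha>) = h \<otimes> \<alpha>"
      unfolding r_coset_def by blast
    then show ?thesis
      using inv \<open>\<alpha> \<in> carrier G\<close> by simp
  qed
  ultimately show ?thesis
    by (simp add: sum.reindex[OF inj])
qed

text \<open>Each coset \<open>H #> x\<close> is a free orbit under left multiplication, so an
  equivariant map to \<open>H\<close> amounts to a base point in each coset, sent to the unit.
  Taking the base point from \<open>R\<close> whenever the coset meets \<open>R\<close> gives the
  value on \<open>R\<close>.\<close>

lemma (in group) ex_retraction:
  assumes H: "subgroup H G" and R: "R \<subseteq> carrier G" "disjoint_family_on (\<lambda>\<alpha>. H #> \<alpha>) R"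
  shows "\<exists>p. (\<forall>x\<in>carrier G. p x \<in> H) \<and> (\<forall>h\<in>H. \<forall>x\<in>carrier G. p (h \<otimes> x) = h \<otimes> p x) \<and>
    (\<forall>\<alpha>\<in>R. p \<alpha> = \<one>)"
proof -
  define rep where "rep C = (SOME y. y \<in> C \<and> (R \<inter> C \<noteq> {} \<longrightarrow> y \<in> R))" for C
  have Hsub: "H \<subseteq> carrier G" using H by (rule subgroup.subset)
  have rep: "rep (H #> x) \<in> H #> x \<and> (R \<inter> (H #> x) \<noteq> {} \<longrightarrow> rep (H #> x) \<in> R)" if "x \<in> carrier G" for x
    unfolding rep_def
    by (rule someI_ex) (use rcos_self[OF that H] in blast)
  define p where "p x = x \<otimes> inv (rep (H #> x))" for x
  have *: "\<exists>h\<in>H. rep (H #> x) = h \<otimes> x" if "x \<in> carrier G" for x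
    using rep[OF that] by (auto simp: r_coset_def)
  have "p x \<in> H" if x: "x \<in> carrier G" for x
  proof -
    from *[OF x] obtain h where h: "h \<in> H" "rep (H #> x) = h \<otimes> x" by blast
    then have "p x = inv h"
      using x Hsub by (auto simp: p_def inv_mult_group m_assoc[symmetric])
    then show ?thesis
      using h H by (simp add: subgroup.m_inv_closed)
  qed
  moreover have "p (h \<otimes> x) = h \<otimes> p x" if "h \<in> H" "x \<in> carrier G" for h x
  proof -
    have "h \<otimes> x \<in> H #> x"
      using that by (auto simp: r_coset_def)
    then have "H #> (h \<otimes> x) = H #> x"
      using repr_independence[OF _ that(2) H] by simp
    moreover have "rep (H #> x) \<in> carrier G"
      using *[OF that(2)] that Hsub by auto
    ultimately show ?thesis
      using that Hsub by (auto simp: p_def m_assoc)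
  qed
  moreover have "p \<alpha> = \<one>" if "\<alpha> \<in> R" for \<alpha>
  proof -
    have \<alpha>: "\<alpha> \<in> carrier G" "\<alpha> \<in> H #> \<alpha>"
      using that R(1) rcos_self[OF _ H] by auto
    with that rep[OF \<alpha>(1)] have r: "rep (H #> \<alpha>) \<in> H #> \<alpha>" "rep (H #> \<alpha>) \<in> R" by auto
    moreover have "rep (H #> \<alpha>) \<in> H #> rep (H #> \<alpha>)"
      using r R(1) rcos_self[OF _ H] by auto
    ultimately have "rep (H #> \<alpha>) = \<alpha>"
      using R(2) that by (auto simp: disjoint_family_on_def)
    then show ?thesis using \<alpha> by (simp add: p_def)
  qed
  ultimately show ?thesis by blast
qed

text \<open>If \<alpha>\<gamma> = \<xi>\<beta> with \<beta> in \<open>R\<close>, then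
  p(\<alpha>\<gamma>) = \<xi> p(\<beta>) = \<xi>. This also settles existence and uniqueness for the
  definite description in \<open>hecke_xi\<close>.\<close>

lemma (in group) hecke_xi_retraction:
  assumes H: "subgroup H G" and R: "coset_reps G H g R" and g: "g \<in> carrier G"
    and p: "\<forall>h\<in>H. \<forall>x\<in>carrier G. p (h \<otimes> x) = h \<otimes> p x" "\<forall>\<alpha>\<in>R. p \<alpha> = \<one>"
    and \<alpha>: "\<alpha> \<in> R" and \<gamma>: "\<gamma> \<in> H"
  shows "hecke_xi G H R \<alpha> \<gamma> = p (\<alpha> \<otimes> \<gamma>)"
proof -
  have sub: "R \<subseteq> carrier G" and dc: "double_coset G H g = (\<Union>\<alpha>\<in>R. H #> \<alpha>)"
    using R by (auto simp: coset_reps_def)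
  have Hsub: "H \<subseteq> carrier G" using H by (rule subgroup.subset)
  have "\<alpha> \<in> double_coset G H g"
    using dc \<alpha> sub rcos_self[OF _ H] by blast
  then obtain h k where hk: "h \<in> H" "k \<in> H" "\<alpha> = h \<otimes> g \<otimes> k"
    unfolding double_coset_def set_mult_def r_coset_def by blast
  then have "\<alpha> \<otimes> \<gamma> = h \<otimes> g \<otimes> (k \<otimes> \<gamma>)" "k \<otimes> \<gamma> \<in> H"
    using Hsub g \<gamma> H by (auto simp: m_assoc subset_iff subgroup.m_closed)
  then have "\<alpha> \<otimes> \<gamma> \<in> double_coset G H g"
    using hk unfolding double_coset_def set_mult_def r_coset_def by blast
  then obtain \<beta> \<xi> where b: "\<beta> \<in> R" "\<xi> \<in> H" "\<alpha> \<otimes> \<gamma> = \<xi> \<otimes> \<beta>"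
    unfolding dc r_coset_def by blast
  have val: "p (\<xi>' \<otimes> \<beta>') = \<xi>'" if "\<xi>' \<in> H" "\<beta>' \<in> R" for \<xi>' \<beta>'
    using p that sub Hsub by (auto simp: subset_iff)
  show ?thesis
    unfolding hecke_xi_def
  proof (rule the_equality)
    show "p (\<alpha> \<otimes> \<gamma>) \<in> H \<and> (\<exists>\<beta>\<in>R. \<alpha> \<otimes> \<gamma> = p (\<alpha> \<otimes> \<gamma>) \<otimes> \<beta>)"
      using b val[OF b(2,1)] by auto
    fix \<xi>' assume "\<xi>' \<in> H \<and> (\<exists>\<beta>\<in>R. \<alpha> \<otimes> \<gamma> = \<xi>' \<otimes> \<beta>)"
    then show "\<xi>' = p (\<alpha> \<otimes> \<gamma>)"
      using val by metis
  qed
qed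

text \<open>One inclusion moves the right factor across by \<open>sw_mult_borel\<close> with
  parameter 0; the other writes \<open>sw m p t\<close> as \<open>sw m p 0\<close> times a unipotent
  matrix. There is one coset for each element of the field.\<close>

lemma sw_coset_reps:
  assumes p: "Suc p < m"
  shows "coset_reps (GL m) (borel m) (sw m p 0) (range (sw m p) :: 'k::{finite,field} mat set)"
proof -
  interpret group "GL m :: 'k mat monoid" by (rule group_GL)
  let ?B = "borel m :: 'k mat set"
  have B: "subgroup ?B (GL m)" by (rule subgroup_borel)
  have s: "sw m p t \<in> carrier (GL m)" for t :: 'k
    using p by (rule sw_in_GL)
  have BG: "b \<in> carrier (GL m)" if "b \<in> ?B" for b
    using that borel_subset_GL by blast
  have coset: "?B #>\<^bsub>GL m\<^esub> x = {b * x | b. b \<in> ?B}" for x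
    by (auto simp: r_coset_def GL_mult)
  have "double_coset (GL m) ?B (sw m p 0) = (\<Union>\<alpha>\<in>range (sw m p). ?B #>\<^bsub>GL m\<^esub> \<alpha>)"
  proof (intro equalityI subsetI)
    fix x assume "x \<in> double_coset (GL m) ?B (sw m p 0)"
    then obtain b c where bc: "b \<in> ?B" "c \<in> ?B" "x = b * sw m p 0 * c"
      unfolding double_coset_def set_mult_def coset by (auto simp: GL_mult)
    from sw_mult_borel[OF p bc(2), of 0] obtain b' t where "b' \<in> ?B" "sw m p 0 * c = b' * sw m p t"
      by blast
    then have "x = (b * b') * sw m p t" "b * b' \<in> ?B"
      using bc s BG by (simp_all add: GL_mult_assoc[of _ m] borel_mult_closed)
    then show "x \<in> (\<Union>\<alpha>\<in>range (sw m p). ?B #>\<^bsub>GL m\<^esub> \<alpha>)"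
      unfolding coset by blast
  next
    fix x assume "x \<in> (\<Union>\<alpha>\<in>range (sw m p). ?B #>\<^bsub>GL m\<^esub> \<alpha>)"
    then obtain b t where bt: "b \<in> ?B" "x = b * sw m p t"
      unfolding coset by blast
    have r: "row_block m p 1 t 0 1 \<in> ?B"
      using p by (intro row_block_in_borel) auto
    have "sw m p t = sw m p 0 * row_block m p 1 t 0 1"
      using p by (simp add: sw_def row_block_mult_row_block)
    then have "x = b * sw m p 0 * row_block m p 1 t 0 1"
      using bt s BG r by (simp add: GL_mult_assoc[of _ m])
    then show "x \<in> double_coset (GL m) ?B (sw m p 0)"
      unfolding double_coset_def set_mult_def coset using r bt by (auto simp: GL_mult)
  qed
  moreover have "disjoint_family_on (\<lambda>\<alpha>. ?B #>\<^bsub>GL m\<^esub> \<alpha>) (range (sw m p))"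
    unfolding disjoint_family_on_def
  proof (intro ballI impI)
    fix \<alpha> \<beta> assume "\<alpha> \<in> range (sw m p :: 'k \<Rightarrow> _)" "\<beta> \<in> range (sw m p :: 'k \<Rightarrow> _)" and ne: "\<alpha> \<noteq> \<beta>"
    then obtain t u :: 'k where tu: "\<alpha> = sw m p t" "\<beta> = sw m p u" by blast
    show "(?B #>\<^bsub>GL m\<^esub> \<alpha>) \<inter> (?B #>\<^bsub>GL m\<^esub> \<beta>) = {}"
    proof (rule ccontr)
      assume "(?B #>\<^bsub>GL m\<^esub> \<alpha>) \<inter> (?B #>\<^bsub>GL m\<^esub> \<beta>) \<noteq> {}"
      then obtain x where "x \<in> ?B #>\<^bsub>GL m\<^esub> \<alpha>" "x \<in> ?B #>\<^bsub>GL m\<^esub> \<beta>" by blast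
      then have "?B #>\<^bsub>GL m\<^esub> \<alpha> = ?B #>\<^bsub>GL m\<^esub> \<beta>"
        using repr_independence[OF _ s B] tu by metis
      then have "\<alpha> \<in> ?B #>\<^bsub>GL m\<^esub> \<beta>"
        using rcos_self[OF s B] tu by metis
      then obtain b where "b \<in> ?B" "sw m p t = b * sw m p u"
        unfolding coset tu by blast
      then show False
        using sw_coset_unique[OF p] ne tu by blast
    qed
  qed
  ultimately show ?thesis
    unfolding coset_reps_def using s by blast
qed

lemma inj_sw:
  assumes "Suc p < m"
  shows "inj (sw m p)"
proof (rule injI)
  fix t u :: 'a
  assume "sw m p t = sw m p u"
  then have "sw m p t $$ (Suc p, Suc p) = sw m p u $$ (Suc p, Suc p)" by simp
  then show "t = u" using assms by (simp add: sw_def row_block_def)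
qed

lemma ex_borel_retraction:
  assumes "R \<subseteq> carrier (GL m)" "disjoint_family_on (\<lambda>\<alpha>. borel m #>\<^bsub>GL m\<^esub> \<alpha>) R"
  shows "\<exists>p. equivariant (borel m) (carrier (GL m)) (borel m) (borel m :: 'k::{finite,field} mat set) id p \<and>
    (\<forall>\<alpha>\<in>R. p \<alpha> = 1\<^sub>m m)"
  using group.ex_retraction[OF group_GL subgroup_borel assms]
  by (auto simp: equivariant_def GL_mult GL_one image_subset_iff)

text \<open>One equivariant map is fixed once and for all; by \<open>cohom_homotopy\<close> any
  other gives the same classes.\<close>

definition retraction :: "nat \<Rightarrow> 'k::{finite,field} mat \<Rightarrow> 'k mat" where
  "retraction m = (SOME p. equivariant (borel m) (carrier (GL m)) (borel m) (borel m) id p)"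

lemma equivariant_retraction:
  "equivariant (borel m) (carrier (GL m)) (borel m) (borel m) id (retraction m)"
proof -
  have "\<exists>p. equivariant (borel m) (carrier (GL m)) (borel m) (borel m :: 'a mat set) id p"
    using ex_borel_retraction[of "{}" m] by (simp add: disjoint_family_on_def)
  then show ?thesis
    unfolding retraction_def by (rule someI_ex)
qed

section \<open>The 0-Hecke action on invariant functions\<close>

lemma map_mult_mult:
  assumes "g \<in> carrier (GL m)" "h \<in> carrier (GL m)" "xs \<in> lists (carrier (GL m))"
  shows "map ((*) g) (map ((*) h) xs) = map ((*) (g * h)) xs"
  using assms by (auto simp: GL_mult_assoc[OF assms(1,2)])

definition hecke_T :: "nat \<Rightarrow> nat \<Rightarrow> ('k mat list \<Rightarrow> 'k) \<Rightarrow> 'k mat list \<Rightarrow> 'k::{finite,field}" where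
  "hecke_T m p \<phi> xs = (\<Sum>t\<in>UNIV. \<phi> (map ((*) (sw m p t)) xs))"

definition hecke_P :: "nat \<Rightarrow> nat \<Rightarrow> ('k mat list \<Rightarrow> 'k) \<Rightarrow> 'k mat list \<Rightarrow> 'k::{finite,field}" where
  "hecke_P m p \<phi> xs = \<phi> xs + hecke_T m p \<phi> xs"

text \<open>The rightmost letter acts first, so concatenation of words is composition of operators;
  the letter \<open>j\<close> acts at position \<open>j - 1\<close>.\<close>

definition hecke_word :: "nat \<Rightarrow> nat list \<Rightarrow> ('k mat list \<Rightarrow> 'k) \<Rightarrow> 'k mat list \<Rightarrow> 'k::{finite,field}" where
  "hecke_word m = foldr (\<lambda>j. hecke_P m (j - 1))"

lemma hecke_word_simps [simp]:
  "hecke_word m [] \<phi> = \<phi>"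
  "hecke_word m (j # u) \<phi> = hecke_P m (j - 1) (hecke_word m u \<phi>)"
  "hecke_word m (u @ v) \<phi> = hecke_word m u (hecke_word m v \<phi>)"
  by (simp_all add: hecke_word_def)

text \<open>This is what a domain needs for \<open>hecke_T\<close> at position \<open>p\<close> to
  act on its invariant functions; the instances are the full linear group and suitable block
  parabolics.\<close>

definition hecke_stable :: "nat \<Rightarrow> nat \<Rightarrow> 'k::{finite,field} mat set \<Rightarrow> bool" where
  "hecke_stable m p X \<longleftrightarrow> Suc p < m \<and> X \<subseteq> carrier (GL m) \<and> (\<forall>b\<in>borel m. \<forall>x\<in>X. b * x \<in> X) \<and>
    (\<forall>t. \<forall>x\<in>X. sw m p t * x \<in> X)"

lemma stable_GL: "Suc p < m \<Longrightarrow> hecke_stable m p (carrier (GL m))"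
  by (auto simp: hecke_stable_def GL_mult_closed sw_in_GL subsetD[OF borel_subset_GL])

lemma stable_block_parabolic:
  "Suc p < m \<Longrightarrow> Suc p < n \<or> n \<le> p \<Longrightarrow> hecke_stable m p (block_parabolic n m)"
  unfolding hecke_stable_def
  using block_parabolic_subset_GL borel_subset_block_parabolic block_parabolic_mult_closed sw_in_block_parabolic
  by blast

lemma stable_map:
  "hecke_stable m p X \<Longrightarrow> xs \<in> lists X \<Longrightarrow> map ((*) (sw m p t)) xs \<in> lists X"
  "hecke_stable m p X \<Longrightarrow> xs \<in> tup X i \<Longrightarrow> map ((*) (sw m p t)) xs \<in> tup X i"
  by (auto simp: hecke_stable_def tup_def)

lemma hecke_T_add: "hecke_T m p (\<lambda>xs. \<phi> xs + \<psi> xs) = (\<lambda>xs. hecke_T m p \<phi> xs + hecke_T m p \<psi> xs)"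
  by (simp add: hecke_T_def sum.distrib fun_eq_iff)

lemma hecke_T_scale: "hecke_T m p (\<lambda>xs. a * \<phi> xs) = (\<lambda>xs. a * hecke_T m p \<phi> xs)"
  by (simp add: hecke_T_def sum_distrib_left fun_eq_iff)

lemma delta_hecke_T: "delta (hecke_T m p \<phi>) xs = hecke_T m p (delta \<phi>) xs"
  by (simp add: hecke_T_def[abs_def] delta_sum delta_map)

lemma hecke_T_cong:
  "\<lbrakk>hecke_stable m p X; \<And>xs. xs \<in> tup X i \<Longrightarrow> \<phi> xs = \<psi> xs; xs \<in> tup X i\<rbrakk> \<Longrightarrow> hecke_T m p \<phi> xs = hecke_T m p \<psi> xs"
  unfolding hecke_T_def by (intro sum.cong refl) (blast intro: stable_map(2))

lemma invar_map_mult: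
  assumes "invar (borel m) X \<phi>" "hecke_stable m p X" "b \<in> borel m" "h \<in> carrier (GL m)"
    "\<forall>x\<in>X. h * x \<in> X" "xs \<in> lists X"
  shows "\<phi> (map ((*) (b * h)) xs) = \<phi> (map ((*) h) xs)"
proof -
  have "map ((*) b) (map ((*) h) xs) = map ((*) (b * h)) xs"
    using assms borel_subset_GL unfolding hecke_stable_def by (intro map_mult_mult) auto
  moreover have "map ((*) h) xs \<in> lists X"
    using assms by auto
  ultimately show ?thesis
    using assms(1,3) unfolding invar_def by metis
qed

text \<open>By \<open>sw_mult_borel\<close>, translating the argument by \<open>g\<close> permutes
  the summands up to left factors from the Borel subgroup. The substitution \<open>\<tau>\<close> is
  an affine bijection of the field, since the diagonal entries of \<open>g\<close> are
  nonzero.\<close>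

lemma invar_hecke_T:
  fixes X :: "'k::{finite,field} mat set"
  assumes \<phi>: "invar (borel m) X \<phi>" and X: "hecke_stable m p X"
  shows "invar (borel m) X (hecke_T m p \<phi>)"
  unfolding invar_def
proof (intro ballI)
  fix g :: "'k mat" and xs assume g: "g \<in> borel m" and xs: "xs \<in> lists X"
  have p: "Suc p < m" and XG: "X \<subseteq> carrier (GL m)" using X by (auto simp: hecke_stable_def)
  have gG: "g \<in> carrier (GL m)" using g borel_subset_GL by blast
  define \<tau> where "\<tau> t = (g $$ (p, Suc p) + t * g $$ (Suc p, Suc p)) / g $$ (p, p)" for t
  have nz: "g $$ (p, p) \<noteq> 0" "g $$ (Suc p, Suc p) \<noteq> 0"
    using borel_diag_nonzero[OF g] p by auto
  have step: "\<phi> (map ((*) (sw m p t)) (map ((*) g) xs)) = \<phi> (map ((*) (sw m p (\<tau> t))) xs)" for t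
  proof -
    from sw_mult_borel[OF p g] obtain b where b: "b \<in> borel m" "sw m p t * g = b * sw m p (\<tau> t)"
      unfolding \<tau>_def by blast
    have "map ((*) (sw m p t)) (map ((*) g) xs) = map ((*) (sw m p t * g)) xs"
      using xs XG by (intro map_mult_mult[OF sw_in_GL[OF p] gG]) auto
    then show ?thesis
      using b invar_map_mult[OF \<phi> X b(1) sw_in_GL[OF p] _ xs] X by (simp add: hecke_stable_def del: map_map)
  qed
  have "hecke_T m p \<phi> (map ((*) g) xs) = (\<Sum>t\<in>UNIV. \<phi> (map ((*) (sw m p (\<tau> t))) xs))"
    unfolding hecke_T_def step ..
  also have "\<dots> = hecke_T m p \<phi> xs"
    unfolding hecke_T_def
    by (rule sum.reindex_bij_witness[where i = "\<lambda>u. (u * g $$ (p, p) - g $$ (p, Suc p)) / g $$ (Suc p, Suc p)" and j = \<tau>])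
      (use nz in \<open>auto simp: \<tau>_def\<close>)
  finally show "hecke_T m p \<phi> (map ((*) g) xs) = hecke_T m p \<phi> xs" .
qed

lemma closed_hecke_T:
  assumes "closed_cochain X i \<phi>" "hecke_stable m p X"
  shows "closed_cochain X i (hecke_T m p \<phi>)"
  unfolding closed_cochain_def delta_hecke_T unfolding hecke_T_def
proof (intro ballI sum.neutral)
  fix xs t assume "xs \<in> tup X (i + 1)"
  then have "map ((*) (sw m p t)) xs \<in> tup X (i + 1)"
    by (rule stable_map(2)[OF assms(2)])
  then show "delta \<phi> (map ((*) (sw m p t)) xs) = 0"
    using assms(1) by (simp add: closed_cochain_def)
qed

text \<open>The operator commutes with the differential, so it carries a primitive
  \<open>\<eta>\<close> to a primitive; on the empty list the new primitive is a sum of values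
  \<open>\<eta> [] = 0\<close>.\<close>

lemma cohom_hecke_T:
  assumes "cohom (borel m) X i \<phi> \<psi>" "hecke_stable m p X"
  shows "cohom (borel m) X i (hecke_T m p \<phi>) (hecke_T m p \<psi>)"
proof -
  from assms(1) obtain \<eta> where \<eta>: "invar (borel m) X \<eta>" "\<eta> [] = 0"
    "\<forall>xs\<in>tup X i. \<phi> xs - \<psi> xs = delta \<eta> xs"
    unfolding cohom_def by blast
  have "hecke_T m p \<phi> xs - hecke_T m p \<psi> xs = delta (hecke_T m p \<eta>) xs" if "xs \<in> tup X i" for xs
    unfolding delta_hecke_T unfolding hecke_T_def sum_subtractf[symmetric]
    using stable_map(2)[OF assms(2) that] \<eta>(3) by (intro sum.cong) auto
  then show ?thesis
    unfolding cohom_def using invar_hecke_T[OF \<eta>(1) assms(2)] \<eta>(2)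
    by (intro exI[of _ "hecke_T m p \<eta>"]) (auto simp: hecke_T_def)
qed

text \<open>This is q = 0 in the field: the shift by 1 permutes the field, so the sum of all
  elements does not change when 1 is added to each.\<close>

lemma sum_const_field: "(\<Sum>t\<in>(UNIV :: 'k::{finite,field} set). c) = (0 :: 'k)"
proof -
  have "(\<Sum>t\<in>(UNIV :: 'k set). t + 1) = (\<Sum>t\<in>UNIV. t)"
    by (rule sum.reindex_bij_witness[where i = "\<lambda>t. t - 1" and j = "\<lambda>t. t + 1"]) auto
  then have "(\<Sum>t\<in>(UNIV :: 'k set). 1 :: 'k) = 0"
    by (simp add: sum.distrib)
  then show ?thesis
    by simp
qed

text \<open>The usual quadratic relation T^2 = q + (q - 1) T with q = 0. Products with left
  parameter 0 each contribute \<open>\<phi> xs\<close>, q times in all; each of the q - 1 others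
  contributes a full \<open>hecke_T m p \<phi> xs\<close>.\<close>

lemma hecke_T_hecke_T:
  fixes \<phi> :: "'k mat list \<Rightarrow> 'k::{finite,field}"
  assumes \<phi>: "invar (borel m) (carrier (GL m)) \<phi>" and p: "Suc p < m" and xs: "xs \<in> lists (carrier (GL m))"
  shows "hecke_T m p (hecke_T m p \<phi>) xs = - hecke_T m p \<phi> xs"
proof -
  note X = stable_GL[OF p]
  note inv = invar_map_mult[OF \<phi> X _ _ _ xs]
  have 0: "\<phi> (map ((*) (sw m p 0)) (map ((*) (sw m p t)) xs)) = \<phi> xs" for t
  proof -
    have "map ((*) (sw m p 0)) (map ((*) (sw m p t)) xs) = map ((*) (row_block m p 1 t 0 1)) xs"
      using xs by (simp add: map_mult_mult[of _ m] sw_in_GL[OF p] sw_sw_zero[OF p] del: map_map)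
    moreover have "row_block m p 1 t 0 1 \<in> borel m"
      using p by (intro row_block_in_borel) auto
    ultimately show ?thesis
      using \<phi> xs by (simp add: invar_def del: map_map)
  qed
  have 1: "(\<Sum>t\<in>UNIV. \<phi> (map ((*) (sw m p u)) (map ((*) (sw m p t)) xs))) = hecke_T m p \<phi> xs" if "u \<noteq> 0" for u
  proof -
    have "\<phi> (map ((*) (sw m p u)) (map ((*) (sw m p t)) xs)) = \<phi> (map ((*) (sw m p (t + 1 / u))) xs)" for t
    proof -
      have "map ((*) (sw m p u)) (map ((*) (sw m p t)) xs) =
          map ((*) (row_block m p (- 1 / u) 1 0 u * sw m p (t + 1 / u))) xs"
        using xs by (simp add: map_mult_mult[of _ m] sw_in_GL[OF p] sw_sw_nonzero[OF p that] del: map_map)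
      moreover have "row_block m p (- 1 / u) 1 0 u \<in> borel m"
        using p that by (intro row_block_in_borel) auto
      ultimately show ?thesis
        using inv[of _ "sw m p (t + 1 / u)"] sw_in_GL[OF p] by (auto simp: GL_mult_closed simp del: map_map)
    qed
    then have "(\<Sum>t\<in>UNIV. \<phi> (map ((*) (sw m p u)) (map ((*) (sw m p t)) xs))) =
        (\<Sum>t\<in>UNIV. \<phi> (map ((*) (sw m p (t + 1 / u))) xs))" by simp
    also have "\<dots> = hecke_T m p \<phi> xs"
      unfolding hecke_T_def
      by (rule sum.reindex_bij_witness[where i = "\<lambda>t. t - 1 / u" and j = "\<lambda>t. t + 1 / u"]) auto
    finally show ?thesis .
  qed
  \<comment> \<open>The sums are exchanged so that the parameter \<open>u\<close> of the left
    factor, on which the cases depend, is outermost.\<close>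
  have "hecke_T m p (hecke_T m p \<phi>) xs =
      (\<Sum>u\<in>UNIV. \<Sum>t\<in>UNIV. \<phi> (map ((*) (sw m p u)) (map ((*) (sw m p t)) xs)))"
    unfolding hecke_T_def by (rule sum.swap)
  also have "\<dots> = (\<Sum>t\<in>UNIV. \<phi> (map ((*) (sw m p 0)) (map ((*) (sw m p t)) xs))) +
      (\<Sum>u\<in>UNIV - {0}. \<Sum>t\<in>UNIV. \<phi> (map ((*) (sw m p u)) (map ((*) (sw m p t)) xs)))"
    by (rule sum.remove) auto
  also have "\<dots> = (\<Sum>u\<in>UNIV - {0 :: 'k}. hecke_T m p \<phi> xs)"
    unfolding 0 sum_const_field using 1 by (auto intro!: sum.cong simp del: map_map sum_constant)
  also have "\<dots> = (\<Sum>u\<in>(UNIV :: 'k set). hecke_T m p \<phi> xs) - hecke_T m p \<phi> xs"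
    by (simp add: sum_diff1 del: sum_constant)
  also have "\<dots> = - hecke_T m p \<phi> xs"
    unfolding sum_const_field by simp
  finally show ?thesis .
qed

lemma hecke_T_commute:
  assumes "Suc p < m" "Suc q < m" "Suc p < q \<or> Suc q < p" and xs: "xs \<in> lists (carrier (GL m))"
  shows "hecke_T m p (hecke_T m q \<phi>) xs = hecke_T m q (hecke_T m p \<phi>) xs"
proof -
  have "map ((*) (sw m q b)) (map ((*) (sw m p a)) xs) = map ((*) (sw m p a)) (map ((*) (sw m q b)) xs)" for a b
    using xs sw_commute[OF assms(1-3), of _ m a b] by (auto dest!: GL_carrier_mat)
  then have "hecke_T m p (hecke_T m q \<phi>) xs =
      (\<Sum>a\<in>UNIV. \<Sum>b\<in>UNIV. \<phi> (map ((*) (sw m p a)) (map ((*) (sw m q b)) xs)))"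
    unfolding hecke_T_def by (simp only:)
  also have "\<dots> = hecke_T m q (hecke_T m p \<phi>) xs"
    unfolding hecke_T_def by (rule sum.swap)
  finally show ?thesis .
qed

text \<open>The triple sums agree by \<open>sw_braid\<close> after the substitution of
  \<open>b - a * c\<close> for \<open>b\<close> in the innermost sum; the exchanges of summation
  bring the parameters into the order needed on either side.\<close>

lemma hecke_T_braid:
  assumes p: "Suc (Suc p) < m" and xs: "xs \<in> lists (carrier (GL m))"
  shows "hecke_T m p (hecke_T m (Suc p) (hecke_T m p \<phi>)) xs =
    hecke_T m (Suc p) (hecke_T m p (hecke_T m (Suc p) \<phi>)) xs"
proof -
  let ?q = "Suc p"
  define f where "f a b c = \<phi> (map ((*) (sw m ?q a)) (map ((*) (sw m p b)) (map ((*) (sw m ?q c)) xs)))" for a b c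
  have "map ((*) (sw m p c)) (map ((*) (sw m ?q b)) (map ((*) (sw m p a)) xs)) =
      map ((*) (sw m ?q a)) (map ((*) (sw m p (b - a * c))) (map ((*) (sw m ?q c)) xs))" for a b c
    using xs sw_braid[OF p, of _ m c b a] by (auto dest!: GL_carrier_mat)
  then have "hecke_T m p (hecke_T m ?q (hecke_T m p \<phi>)) xs =
      (\<Sum>a\<in>UNIV. \<Sum>b\<in>UNIV. \<Sum>c\<in>UNIV. f a (b - a * c) c)"
    unfolding hecke_T_def f_def by (simp only:)
  also have "\<dots> = (\<Sum>a\<in>UNIV. \<Sum>c\<in>UNIV. \<Sum>b\<in>UNIV. f a (b - a * c) c)"
    by (rule sum.cong[OF refl]) (rule sum.swap)
  also have "\<dots> = (\<Sum>a\<in>UNIV. \<Sum>c\<in>UNIV. \<Sum>b\<in>UNIV. f a b c)"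
  proof (rule sum.cong[OF refl], rule sum.cong[OF refl])
    fix a c :: 'a
    show "(\<Sum>b\<in>UNIV. f a (b - a * c) c) = (\<Sum>b\<in>UNIV. f a b c)"
      by (rule sum.reindex_bij_witness[where i = "\<lambda>b. b + a * c" and j = "\<lambda>b. b - a * c"]) auto
  qed
  also have "\<dots> = (\<Sum>c\<in>UNIV. \<Sum>a\<in>UNIV. \<Sum>b\<in>UNIV. f a b c)"
    by (rule sum.swap)
  also have "\<dots> = (\<Sum>c\<in>UNIV. \<Sum>b\<in>UNIV. \<Sum>a\<in>UNIV. f a b c)"
    by (rule sum.cong[OF refl]) (rule sum.swap)
  also have "\<dots> = hecke_T m ?q (hecke_T m p (hecke_T m ?q \<phi>)) xs"
    unfolding hecke_T_def f_def ..
  finally show ?thesis .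
qed

section \<open>Words in the operators and the 0-Hecke relations\<close>

lemma hecke_P_eq: "hecke_P m p \<phi> = (\<lambda>xs. \<phi> xs + hecke_T m p \<phi> xs)"
  by (simp add: hecke_P_def fun_eq_iff)

abbreviation word_stable :: "nat \<Rightarrow> nat list \<Rightarrow> 'k::{finite,field} mat set \<Rightarrow> bool" where
  "word_stable m u X \<equiv> \<forall>j\<in>set u. hecke_stable m (j - 1) X"

lemma word_stable_GL: "set u \<subseteq> {1..<m} \<Longrightarrow> word_stable m u (carrier (GL m))"
  by (auto intro!: stable_GL)

lemma word_stable_block_parabolic:
  "set u \<subseteq> {1..<n} \<Longrightarrow> n \<le> m \<Longrightarrow> word_stable m u (block_parabolic n m)"
  by (auto intro!: stable_block_parabolic)

lemma invar_hecke_word: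
  assumes "invar (borel m) X \<phi>" "word_stable m u X"
  shows "invar (borel m) X (hecke_word m u \<phi>)"
  using assms(2)
proof (induction u)
  case (Cons j u)
  then have "invar (borel m) X (hecke_T m (j - 1) (hecke_word m u \<phi>))"
    by (intro invar_hecke_T) auto
  with Cons show ?case by (simp add: invar_def hecke_P_def)
qed (simp add: assms(1))

lemma closed_hecke_word:
  assumes "closed_cochain X i \<phi>" "word_stable m u X"
  shows "closed_cochain X i (hecke_word m u \<phi>)"
  using assms(2)
proof (induction u)
  case (Cons j u)
  then have "closed_cochain X i (hecke_T m (j - 1) (hecke_word m u \<phi>))"
    by (intro closed_hecke_T) auto
  with Cons show ?case by (simp add: closed_cochain_def hecke_P_eq delta_add)
qed (simp add: assms(1))

lemma cohom_hecke_word: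
  assumes "cohom (borel m) X i \<phi> \<psi>" "word_stable m u X"
  shows "cohom (borel m) X i (hecke_word m u \<phi>) (hecke_word m u \<psi>)"
  using assms(2)
  by (induction u) (auto simp: assms(1) hecke_P_eq intro!: cohom_add cohom_hecke_T)

lemma hecke_word_cong:
  assumes "\<And>xs. xs \<in> tup X i \<Longrightarrow> \<phi> xs = \<psi> xs" "word_stable m u X" "xs \<in> tup X i"
  shows "hecke_word m u \<phi> xs = hecke_word m u \<psi> xs"
  using assms(2,3)
proof (induction u arbitrary: xs)
  case (Cons j u)
  then have "hecke_T m (j - 1) (hecke_word m u \<phi>) xs = hecke_T m (j - 1) (hecke_word m u \<psi>) xs"
    by (intro hecke_T_cong[of m "j - 1" X i]) auto
  with Cons show ?case by (simp add: hecke_P_def)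
qed (simp add: assms(1))

lemma hecke_word_add:
  "hecke_word m u (\<lambda>xs. \<phi> xs + \<psi> xs) = (\<lambda>xs. hecke_word m u \<phi> xs + hecke_word m u \<psi> xs)"
  by (induction u) (simp_all add: hecke_P_eq hecke_T_add algebra_simps)

lemma hecke_word_scale: "hecke_word m u (\<lambda>xs. a * \<phi> xs) = (\<lambda>xs. a * hecke_word m u \<phi> xs)"
  by (induction u) (simp_all add: hecke_P_eq hecke_T_scale algebra_simps)

text \<open>With P = 1 + T, the relation T^2 = -T gives P^2 = P. In the expansion of a threefold
  product it cancels one of the two linear terms in the repeated operator, so what remains besides
  the cubic term is symmetric in the two positions and the braid relation for T suffices.\<close>

lemma hecke_word_relation:
  assumes "hecke_relation l r" "set l \<subseteq> {1..<m}" and \<phi>: "invar (borel m) (carrier (GL m)) \<phi>"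
    and xs: "xs \<in> tup (carrier (GL m)) i"
  shows "hecke_word m l \<phi> xs = hecke_word m r \<phi> xs"
proof -
  have xs: "xs \<in> lists (carrier (GL m))"
    using xs by (auto simp: tup_def)
  from assms(1) show ?thesis
  proof cases
    case (idem j)
    then have "Suc (j - 1) < m" using assms(2) by auto
    from hecke_T_hecke_T[OF \<phi> this xs] idem show ?thesis
      by (simp add: hecke_P_eq hecke_T_add)
  next
    case (braid j)
    then have p: "Suc (Suc (j - 1)) < m" and j: "j = Suc (j - 1)" using assms(2) by auto
    then have p': "Suc (j - 1) < m" by simp
    have "j + 1 - 1 = Suc (j - 1)" using j by simp
    then have "hecke_word m l \<phi> = hecke_P m (j - 1) (hecke_P m (Suc (j - 1)) (hecke_P m (j - 1) \<phi>))"
      "hecke_word m r \<phi> = hecke_P m (Suc (j - 1)) (hecke_P m (j - 1) (hecke_P m (Suc (j - 1)) \<phi>))"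
      unfolding braid by (simp_all only: hecke_word_simps)
    then show ?thesis
      using hecke_T_hecke_T[OF \<phi> p xs] hecke_T_hecke_T[OF \<phi> p' xs] hecke_T_braid[OF p xs, of \<phi>]
      by (simp add: hecke_P_eq hecke_T_add)
  next
    case (comm j k)
    then have jk: "Suc (j - 1) < m" "Suc (k - 1) < m" "Suc (j - 1) < k - 1 \<or> Suc (k - 1) < j - 1"
      using assms(2) by auto
    from hecke_T_commute[OF jk xs, of \<phi>] comm show ?thesis
      by (simp add: hecke_P_eq hecke_T_add)
  qed
qed

text \<open>The suffix acts first and keeps the function invariant, so the relation applies to its
  result; the prefix respects equality on tuples.\<close>

lemma hecke_word_step:
  assumes "hecke_step v w" "set v \<subseteq> {1..<m}" "invar (borel m) (carrier (GL m)) \<phi>"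
    "xs \<in> tup (carrier (GL m)) i"
  shows "hecke_word m v \<phi> xs = hecke_word m w \<phi> xs"
  using assms(1)
proof cases
  case (1 l r a b)
  have sub: "set a \<subseteq> {1..<m}" "set l \<subseteq> {1..<m}" "set b \<subseteq> {1..<m}"
    using assms(2) 1(1) by auto
  have "hecke_word m l (hecke_word m b \<phi>) ys = hecke_word m r (hecke_word m b \<phi>) ys"
    if "ys \<in> tup (carrier (GL m)) i" for ys
    using 1(3) sub(2) invar_hecke_word[OF assms(3) word_stable_GL[OF sub(3)]] that
    by (rule hecke_word_relation)
  then show ?thesis
    unfolding 1 hecke_word_simps
    using word_stable_GL[OF sub(1)] assms(4) by (rule hecke_word_cong)
qed

lemma hecke_word_hecke_eq:
  assumes "hecke_eq u v" "set u \<subseteq> {1..<m}" "invar (borel m) (carrier (GL m)) \<phi>"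
    "xs \<in> tup (carrier (GL m)) i"
  shows "hecke_word m u \<phi> xs = hecke_word m v \<phi> xs"
  using assms(1) unfolding hecke_eq_def
proof (induction rule: equivclp_induct)
  case (step y z)
  have "hecke_eq u y"
    using step.hyps(1) by (simp add: hecke_eq_def)
  moreover have "hecke_eq y z"
    using step.hyps(2) unfolding hecke_eq_def symclp_def by (auto intro: equivclp_sym r_into_equivclp)
  \<comment> \<open>Equivalent words have the same letters, so no intermediate word leaves the
    allowed range.\<close>
  ultimately have "set y \<subseteq> {1..<m}" "set z \<subseteq> {1..<m}"
    using assms(2) hecke_eq_set by metis+
  then have "hecke_word m y \<phi> xs = hecke_word m z \<phi> xs"
    using step.hyps(2) hecke_word_step[OF _ _ assms(3,4)] unfolding symclp_def by metis
  with step.IH show ?case by simp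
qed simp

lemma prod_list_hecke_gen: "prod_list (map \<pi> u) = abs_hecke_monoid u"
  by (induction u) (simp_all add: one_hecke_monoid.abs_eq hecke_gen.abs_eq times_hecke_monoid.abs_eq)

lemma prod_list_hecke_gen_eq_iff: "prod_list (map \<pi> u) = prod_list (map \<pi> v) \<longleftrightarrow> hecke_eq u v"
  by (simp add: prod_list_hecke_gen hecke_monoid.abs_eq_iff)

section \<open>Hecke operators on functions of the leading block\<close>

lemma map_restrict_mat_sw:
  assumes "n \<le> m" "Suc p < m" "xs \<in> tup (block_parabolic n m) i"
  shows "Suc p < n \<Longrightarrow> map (restrict_mat n) (map ((*) (sw m p t)) xs) =
      map ((*) (sw n p t)) (map (restrict_mat n) xs)"
    and "n \<le> p \<Longrightarrow> map (restrict_mat n) (map ((*) (sw m p t)) xs) = map (restrict_mat n) xs"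
proof -
  have *: "restrict_mat n (sw m p t * x) = restrict_mat n (sw m p t) * restrict_mat n x" if "x \<in> set xs" for x
    using assms that by (intro restrict_mat_mult) (auto simp: tup_def GL_carrier_mat sw_in_GL)
  show "map (restrict_mat n) (map ((*) (sw m p t)) xs) = map ((*) (sw n p t)) (map (restrict_mat n) xs)"
    if "Suc p < n"
    using that assms(1) * by (auto simp: restrict_mat_sw)
  show "map (restrict_mat n) (map ((*) (sw m p t)) xs) = map (restrict_mat n) xs" if "n \<le> p"
  proof -
    have "1\<^sub>m n * restrict_mat n x = restrict_mat n x" for x :: "'a mat"
      by (rule left_mult_one_mat[of _ n n]) (simp add: restrict_mat_def)
    then show ?thesis
      using that assms(1) * by (auto simp: restrict_mat_sw)
  qed
qed

lemma hecke_word_restrict_mat: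
  assumes "n \<le> m" "set u \<subseteq> {1..<n}" "xs \<in> tup (block_parabolic n m) i"
  shows "hecke_word m u (\<lambda>ys. \<phi> (map (restrict_mat n) ys)) xs = hecke_word n u \<phi> (map (restrict_mat n) xs)"
  using assms(2,3)
proof (induction u arbitrary: xs)
  case (Cons j u)
  have j: "Suc (j - 1) < n" "Suc (j - 1) < m" using Cons.prems(1) assms(1) by auto
  have "map ((*) (sw m (j - 1) t)) xs \<in> tup (block_parabolic n m) i" for t
    using Cons.prems(2) j by (intro stable_map(2) stable_block_parabolic) auto
  then have "hecke_T m (j - 1) (hecke_word m u (\<lambda>ys. \<phi> (map (restrict_mat n) ys))) xs =
      hecke_T n (j - 1) (hecke_word n u \<phi>) (map (restrict_mat n) xs)"
    using Cons.IH Cons.prems map_restrict_mat_sw(1)[OF assms(1) j(2) Cons.prems(2) j(1)]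
    unfolding hecke_T_def by (simp del: map_map)
  with Cons show ?case by (simp add: hecke_P_eq)
qed simp

text \<open>Representatives below the leading block restrict to the identity there, so all q
  summands are equal and their sum is 0.\<close>

lemma hecke_T_restrict_mat_zero:
  assumes "n \<le> p" "Suc p < m" "xs \<in> tup (block_parabolic n m) i"
  shows "hecke_T m p (\<lambda>ys. \<phi> (map (restrict_mat n) ys)) xs = 0"
proof -
  have "n \<le> m" using assms by simp
  from map_restrict_mat_sw(2)[OF this assms(2,3,1)] show ?thesis
    by (simp add: hecke_T_def sum_const_field del: map_map sum_constant)
qed

section \<open>Comparison of Borel subgroups of different ranks\<close>

lemma equivariant_restrict_mat:
  "n \<le> m \<Longrightarrow> equivariant (borel m) (borel m) (borel n) (borel n :: 'k::{finite,field} mat set) (restrict_mat n) (restrict_mat n)"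
  "n \<le> m \<Longrightarrow> equivariant (borel m) (block_parabolic n m) (borel n) (carrier (GL n) :: 'k::{finite,field} mat set) (restrict_mat n) (restrict_mat n)"
  using borel_subset_block_parabolic[of m n]
  by (auto simp: equivariant_def restrict_mat_in_borel restrict_mat_in_GL borel_carrier_mat intro!: restrict_mat_mult)

text \<open>Inflation along the restriction of Borel subgroups, extended to tuples in the full
  linear group by first applying the retraction; only there do all Hecke operators of rank
  \<open>m\<close> act.\<close>

definition inflate :: "nat \<Rightarrow> nat \<Rightarrow> ('k mat list \<Rightarrow> 'k) \<Rightarrow> 'k mat list \<Rightarrow> 'k::{finite,field}" where
  "inflate n m \<phi> xs = \<phi> (map (restrict_mat n \<circ> retraction m) xs)"

lemma equivariant_inflate:
  "n \<le> m \<Longrightarrow> equivariant (borel m) (carrier (GL m)) (borel n) (borel n) (restrict_mat n) (restrict_mat n \<circ> retraction m)"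
  using equivariant_comp[OF equivariant_retraction equivariant_restrict_mat(1)] by simp

lemma inflate:
  assumes "n \<le> m"
  shows "invar (borel n) (borel n) \<phi> \<Longrightarrow> invar (borel m) (carrier (GL m)) (inflate n m \<phi>)"
    and "closed_cochain (borel n) i \<phi> \<Longrightarrow> closed_cochain (carrier (GL m)) i (inflate n m \<phi>)"
    and "cohom (borel n) (borel n) i \<phi> \<psi> \<Longrightarrow> cohom (borel m) (carrier (GL m)) i (inflate n m \<phi>) (inflate n m \<psi>)"
proof -
  note e = equivariant_inflate[OF assms]
  have im: "(restrict_mat n \<circ> retraction m) ` carrier (GL m) \<subseteq> borel n"
    using e unfolding equivariant_def by blast
  show "invar (borel n) (borel n) \<phi> \<Longrightarrow> invar (borel m) (carrier (GL m)) (inflate n m \<phi>)"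
    unfolding inflate_def[abs_def] using e by (rule invar_pullback[rotated])
  show "closed_cochain (borel n) i \<phi> \<Longrightarrow> closed_cochain (carrier (GL m)) i (inflate n m \<phi>)"
    unfolding inflate_def[abs_def] using im by (rule closed_pullback[rotated])
  show "cohom (borel n) (borel n) i \<phi> \<psi> \<Longrightarrow> cohom (borel m) (carrier (GL m)) i (inflate n m \<phi>) (inflate n m \<psi>)"
    unfolding inflate_def[abs_def] using e by (rule cohom_pullback[rotated])
qed

text \<open>The identity and the retraction are equivariant maps into the full linear group, so each
  cocycle is cohomologous to the pullback of its own restriction to the Borel subgroup. Comparisons
  can therefore be made on Borel tuples.\<close>

lemma cohom_borel_imp_GL:
  fixes \<phi> \<psi> :: "'k::{finite,field} mat list \<Rightarrow> 'k"
  assumes \<phi>: "invar (borel m) (carrier (GL m)) \<phi>" "closed_cochain (carrier (GL m)) i \<phi>"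
    and \<psi>: "invar (borel m) (carrier (GL m)) \<psi>" "closed_cochain (carrier (GL m)) i \<psi>"
    and "cohom (borel m) (borel m) i \<phi> \<psi>"
  shows "cohom (borel m) (carrier (GL m)) i \<phi> \<psi>"
proof -
  note e = equivariant_mono[OF equivariant_retraction order_refl borel_subset_GL]
  have id: "equivariant (borel m) (carrier (GL m)) (borel m) (carrier (GL m)) id id"
    by (simp add: equivariant_def)
  have "cohom (borel m) (carrier (GL m)) i (\<lambda>xs. \<phi> (map id xs)) (\<lambda>xs. \<phi> (map (retraction m) xs))"
    using \<phi> e id by (rule cohom_homotopy)
  also have "cohom (borel m) (carrier (GL m)) i (\<lambda>xs. \<phi> (map (retraction m) xs)) (\<lambda>xs. \<psi> (map (retraction m) xs))"
    using assms(5) equivariant_retraction by (rule cohom_pullback)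
  also have "cohom (borel m) (carrier (GL m)) i (\<lambda>xs. \<psi> (map (retraction m) xs)) (\<lambda>xs. \<psi> (map id xs))"
    using \<psi> id e by (rule cohom_homotopy)
  finally show ?thesis by simp
qed

text \<open>This is the compatibility behind composition of morphisms. On Borel tuples of rank
  \<open>l\<close> the outer inflation may be replaced by plain restriction, through which the word
  passes by \<open>hecke_word_restrict_mat\<close>; the two remaining ways of inflating from rank
  \<open>n\<close> are homotopic.\<close>

lemma inflate_hecke_word:
  fixes \<phi> :: "'k::{finite,field} mat list \<Rightarrow> 'k"
  assumes le: "n \<le> m" "m \<le> l" and v: "set v \<subseteq> {1..<m}"
    and \<phi>: "invar (borel n) (borel n) \<phi>" "closed_cochain (borel n) i \<phi>"
  shows "cohom (borel l) (carrier (GL l)) i (inflate m l (hecke_word m v (inflate n m \<phi>)))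
    (hecke_word l v (inflate n l \<phi>))"
proof (rule cohom_borel_imp_GL)
  have nl: "n \<le> l" and vl: "set v \<subseteq> {1..<l}"
    using le v by auto
  let ?\<psi> = "hecke_word m v (inflate n m \<phi>)"
  have \<psi>: "invar (borel m) (carrier (GL m)) ?\<psi>" "closed_cochain (carrier (GL m)) i ?\<psi>"
    using \<phi> by (intro invar_hecke_word closed_hecke_word inflate le word_stable_GL v; simp)+
  show "invar (borel l) (carrier (GL l)) (inflate m l ?\<psi>)"
    using \<psi>(1) by (intro inflate(1) le(2) invar_mono[OF _ borel_subset_GL])
  show "closed_cochain (carrier (GL l)) i (inflate m l ?\<psi>)"
    using \<psi>(2) by (intro inflate(2) le(2) closed_cochain_mono[OF _ borel_subset_GL])
  show "invar (borel l) (carrier (GL l)) (hecke_word l v (inflate n l \<phi>))"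
    "closed_cochain (carrier (GL l)) i (hecke_word l v (inflate n l \<phi>))"
    using \<phi> by (intro invar_hecke_word closed_hecke_word inflate nl word_stable_GL vl; simp)+
  note e1 = equivariant_mono[OF equivariant_inflate[OF le(2)] borel_subset_GL borel_subset_GL]
  note e2 = equivariant_mono[OF equivariant_restrict_mat(1)[OF le(2)] order_refl borel_subset_GL]
  have "cohom (borel l) (borel l) i (inflate m l ?\<psi>) (\<lambda>xs. ?\<psi> (map (restrict_mat m) xs))"
    unfolding inflate_def[of m l, abs_def] using \<psi> e2 e1 by (rule cohom_homotopy)
  also have "cohom (borel l) (borel l) i (\<lambda>xs. ?\<psi> (map (restrict_mat m) xs))
      (hecke_word l v (\<lambda>ys. inflate n m \<phi> (map (restrict_mat m) ys)))"
    using hecke_word_restrict_mat[OF le(2) v tup_mono[OF borel_subset_block_parabolic], where \<phi> = "inflate n m \<phi>"]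
    by (intro cohom_eq) simp
  \<comment> \<open>The Borel subgroup is not stable under the operators in general, so the
    inflations are compared on the block parabolic, the word is applied there, and only then is the
    result restricted.\<close>
  also have "cohom (borel l) (borel l) i \<dots> (hecke_word l v (inflate n l \<phi>))"
  proof (rule cohom_mono[OF cohom_hecke_word borel_subset_block_parabolic])
    have "restrict_mat n \<circ> restrict_mat m = (restrict_mat n :: 'k mat \<Rightarrow> 'k mat)"
      by (simp add: fun_eq_iff restrict_mat_restrict_mat[OF le(1)])
    moreover have "equivariant (borel l) (block_parabolic m l) (borel n) (borel n)
        (restrict_mat n \<circ> restrict_mat m) (restrict_mat n \<circ> retraction m \<circ> restrict_mat m :: 'k mat \<Rightarrow> 'k mat)"
      by (rule equivariant_comp[OF equivariant_restrict_mat(2)[OF le(2)] equivariant_inflate[OF le(1)]])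
    ultimately have e: "equivariant (borel l) (block_parabolic m l) (borel n) (borel n) (restrict_mat n)
        (restrict_mat n \<circ> retraction m \<circ> restrict_mat m :: 'k mat \<Rightarrow> 'k mat)"
      by (simp only:)
    note e' = equivariant_mono[OF equivariant_inflate[OF nl] block_parabolic_subset_GL order_refl]
    from cohom_homotopy[OF \<phi> e' e]
    show "cohom (borel l) (block_parabolic m l) i (\<lambda>ys. inflate n m \<phi> (map (restrict_mat m) ys)) (inflate n l \<phi>)"
      by (simp add: inflate_def[abs_def] comp_assoc)
    show "word_stable l v (block_parabolic m l)"
      using v le(2) by (rule word_stable_block_parabolic)
  qed
  finally show "cohom (borel l) (borel l) i (inflate m l ?\<psi>) (hecke_word l v (inflate n l \<phi>))" .
qed

text \<open>Position \<open>p\<close> belongs to the letter \<open>p + 1\<close>, so these are the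
  generators absorbed in morphisms out of rank \<open>n\<close>. On the block parabolic the inflated
  cocycle is cohomologous to a function of leading blocks, which \<open>hecke_T\<close>
  annihilates.\<close>

lemma hecke_P_inflate:
  assumes p: "n \<le> p" "Suc p < m"
    and \<phi>: "invar (borel n) (borel n) \<phi>" "closed_cochain (borel n) i \<phi>"
  shows "cohom (borel m) (carrier (GL m)) i (hecke_P m p (inflate n m \<phi>)) (inflate n m \<phi>)"
proof -
  have nm: "n \<le> m" using p by simp
  have good: "invar (borel m) (carrier (GL m)) (inflate n m \<phi>)" "closed_cochain (carrier (GL m)) i (inflate n m \<phi>)"
    using inflate[OF nm] \<phi> by auto
  have "cohom (borel m) (carrier (GL m)) i (hecke_T m p (inflate n m \<phi>)) (\<lambda>_. 0)"
  proof (rule cohom_borel_imp_GL)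
    show "invar (borel m) (carrier (GL m)) (hecke_T m p (inflate n m \<phi>))"
      "closed_cochain (carrier (GL m)) i (hecke_T m p (inflate n m \<phi>))"
      using good p by (intro invar_hecke_T closed_hecke_T stable_GL; simp)+
    show "invar (borel m) (carrier (GL m)) (\<lambda>_. 0)" "closed_cochain (carrier (GL m)) i (\<lambda>_. 0)"
      by (simp_all add: invar_def closed_cochain_def delta_zero)
    have e: "equivariant (borel m) (block_parabolic n m) (borel n) (borel n) (restrict_mat n)
        (retraction n \<circ> restrict_mat n)"
      using equivariant_comp[OF equivariant_restrict_mat(2)[OF nm] equivariant_retraction] by simp
    note e' = equivariant_mono[OF equivariant_inflate[OF nm] block_parabolic_subset_GL order_refl]
    have "cohom (borel m) (block_parabolic n m) i (inflate n m \<phi>) (\<lambda>xs. \<phi> (map (retraction n \<circ> restrict_mat n) xs))"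
      unfolding inflate_def[abs_def] using \<phi> e e' by (rule cohom_homotopy)
    then have "cohom (borel m) (block_parabolic n m) i (hecke_T m p (inflate n m \<phi>))
        (hecke_T m p (\<lambda>xs. \<phi> (map (retraction n \<circ> restrict_mat n) xs)))"
      using p by (intro cohom_hecke_T stable_block_parabolic) auto
    also have "cohom (borel m) (block_parabolic n m) i \<dots> (\<lambda>_. 0)"
      using hecke_T_restrict_mat_zero[OF p, where \<phi> = "\<lambda>ys. \<phi> (map (retraction n) ys)"]
      by (intro cohom_eq) simp
    finally show "cohom (borel m) (borel m) i (hecke_T m p (inflate n m \<phi>)) (\<lambda>_. 0)"
      using borel_subset_block_parabolic by (rule cohom_mono)
  qed
  from cohom_add[OF cohom_refl[of _ _ _ "inflate n m \<phi>"] this] show ?thesis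
    by (simp add: hecke_P_eq)
qed

section \<open>Cohomology classes\<close>

text \<open>Multiplication in the carrier is the operation of the type class, so that the predicates
  on functions of tuples apply to the given definition of group cohomology.\<close>

locale concrete_group = group G for G :: "('g::times, 'b) monoid_scheme" (structure) +
  assumes mult_eq: "mult G = (*)"
begin

abbreviation "\<Gamma> \<equiv> carrier G"

definition cut :: "nat \<Rightarrow> ('g list \<Rightarrow> 'k::field) \<Rightarrow> 'g list \<Rightarrow> 'k" where
  "cut i \<phi> xs = (if xs \<in> tup \<Gamma> i then \<phi> xs else 0)"

definition cocycle :: "nat \<Rightarrow> ('g list \<Rightarrow> 'k::field) \<Rightarrow> bool" where
  "cocycle i \<phi> \<longleftrightarrow> invar \<Gamma> \<Gamma> \<phi> \<and> closed_cochain \<Gamma> i \<phi>"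

text \<open>The cohomology class as an explicit set of normalised cochains. Its members vanish off
  the tuples, while \<open>\<phi>\<close> may be any function and enters only through its values on
  them.\<close>

definition cls :: "nat \<Rightarrow> ('g list \<Rightarrow> 'k::field) \<Rightarrow> ('g list \<Rightarrow> 'k) set" where
  "cls i \<phi> = {\<chi>. (\<forall>xs. xs \<notin> tup \<Gamma> i \<longrightarrow> \<chi> xs = 0) \<and> cohom \<Gamma> \<Gamma> i \<chi> \<phi>}"

section \<open>Comparison with the defining cochains, cocycles and coboundaries\<close>

lemma tuples_eq: "tuples G i = tup \<Gamma> i"
  by (simp add: tuples_def tup_def)

lemma map_mult_tup: "g \<in> \<Gamma> \<Longrightarrow> map ((*) g) xs \<in> tup \<Gamma> i \<longleftrightarrow> xs \<in> tup \<Gamma> i" if "xs \<in> lists \<Gamma>"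
  using that by (auto simp: tup_def mult_eq[symmetric])

text \<open>Outside the tuples of degree \<open>i\<close> both sides of the invariance equation are
  0, so invariance in one degree is the same as invariance on all lists.\<close>

lemma cochains_iff: "\<phi> \<in> cochains G i \<longleftrightarrow> (\<forall>xs. xs \<notin> tup \<Gamma> i \<longrightarrow> \<phi> xs = 0) \<and> invar \<Gamma> \<Gamma> \<phi>"
proof -
  have "(\<forall>g\<in>\<Gamma>. \<forall>xs\<in>tup \<Gamma> i. \<phi> (map ((*) g) xs) = \<phi> xs) \<longleftrightarrow> invar \<Gamma> \<Gamma> \<phi>"
    if "\<forall>xs. xs \<notin> tup \<Gamma> i \<longrightarrow> \<phi> xs = 0"
    unfolding invar_def
  proof (intro iffI ballI)
    fix g xs assume *: "\<forall>g\<in>\<Gamma>. \<forall>xs\<in>tup \<Gamma> i. \<phi> (map ((*) g) xs) = \<phi> xs" "g \<in> \<Gamma>" "xs \<in> lists \<Gamma>"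
    show "\<phi> (map ((*) g) xs) = \<phi> xs"
      using * map_mult_tup[of xs g i] that by (cases "xs \<in> tup \<Gamma> i") auto
  next
    fix g xs assume "\<forall>\<gamma>\<in>\<Gamma>. \<forall>xs\<in>lists \<Gamma>. \<phi> (map ((*) \<gamma>) xs) = \<phi> xs" "g \<in> \<Gamma>" "xs \<in> tup \<Gamma> i"
    then show "\<phi> (map ((*) g) xs) = \<phi> xs" by (auto simp: tup_def)
  qed
  then show ?thesis
    unfolding cochains_def mult_eq tuples_eq by blast
qed

lemma differential_eq: "differential G i \<phi> xs = (if xs \<in> tup \<Gamma> (i + 1) then delta \<phi> xs else 0)"
proof -
  have "{..i + 1} = {..<length xs}" if "xs \<in> tup \<Gamma> (i + 1)"
    using that by (auto simp: tup_def)
  then show ?thesis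
    unfolding differential_def tuples_eq by (simp add: delta_eq_sum)
qed

lemma cut_eq: "xs \<in> tup \<Gamma> i \<Longrightarrow> cut i \<phi> xs = \<phi> xs"
  by (simp add: cut_def)

lemma invar_cut:
  assumes "invar \<Gamma> \<Gamma> \<phi>"
  shows "invar \<Gamma> \<Gamma> (cut i \<phi>)"
  using assms map_mult_tup unfolding invar_def cut_def by metis

lemma delta_cong_tup:
  assumes "\<And>ys. ys \<in> tup \<Gamma> i \<Longrightarrow> \<phi> ys = \<psi> ys" "xs \<in> tup \<Gamma> (i + 1)"
  shows "delta \<phi> xs = delta \<psi> xs"
  using assms by (intro delta_cong) (auto simp: tup_def)

lemma cocycles_iff: "\<phi> \<in> cocycles G i \<longleftrightarrow> (\<forall>xs. xs \<notin> tup \<Gamma> i \<longrightarrow> \<phi> xs = 0) \<and> cocycle i \<phi>"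
  by (auto simp: cocycles_def cochains_iff cocycle_def closed_cochain_def differential_eq fun_eq_iff)

lemma coboundaries_eq: "coboundaries G i = cls i (\<lambda>_. 0)"
proof (intro equalityI subsetI)
  fix \<phi> :: "'g list \<Rightarrow> 'k::field" assume \<phi>: "\<phi> \<in> coboundaries G i"
  show "\<phi> \<in> cls i (\<lambda>_. 0)"
  proof (cases i)
    case 0
    with \<phi> show ?thesis by (simp add: coboundaries_def cls_def cohom_refl)
  next
    case (Suc k)
    with \<phi> obtain \<psi> where \<psi>: "\<psi> \<in> cochains G k" "\<phi> = differential G k \<psi>"
      by (auto simp: coboundaries_def)
    \<comment> \<open>As a cochain, \<open>\<psi>\<close> vanishes on the empty list, as
      \<open>cohom\<close> demands of a primitive.\<close>
    then have "cohom \<Gamma> \<Gamma> i \<phi> (\<lambda>_. 0)"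
      unfolding cohom_def using Suc
      by (intro exI[of _ \<psi>]) (auto simp: cochains_iff differential_eq tup_def)
    then show ?thesis
      using \<psi> Suc by (simp add: cls_def differential_eq)
  qed
next
  fix \<phi> :: "'g list \<Rightarrow> 'k::field" assume "\<phi> \<in> cls i (\<lambda>_. 0)"
  then obtain \<eta> where out: "\<And>xs. xs \<notin> tup \<Gamma> i \<Longrightarrow> \<phi> xs = 0"
    and \<eta>: "invar \<Gamma> \<Gamma> \<eta>" "\<eta> [] = 0" "\<And>xs. xs \<in> tup \<Gamma> i \<Longrightarrow> \<phi> xs = delta \<eta> xs"
    by (auto simp: cls_def cohom_def)
  show "\<phi> \<in> coboundaries G i"
  proof (cases i)
    case 0
    \<comment> \<open>In degree 0 the differential of \<open>\<eta>\<close> at \<open>[x]\<close> is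
      \<open>\<eta> []\<close>, which is 0.\<close>
    have "\<phi> xs = 0" for xs
    proof (cases "xs \<in> tup \<Gamma> i")
      case True
      then obtain x where "xs = [x]"
        using 0 by (auto simp: tup_def length_Suc_conv)
      with \<eta>(2,3) True show ?thesis by simp
    qed (rule out)
    then show ?thesis by (simp add: 0 coboundaries_def fun_eq_iff)
  next
    case (Suc k)
    \<comment> \<open>The differential in degree \<open>k\<close> sees \<open>\<eta>\<close> only on
      tuples of that degree, so cutting it down to a cochain preserves its coboundary.\<close>
    have "cut k \<eta> \<in> cochains G k"
      using invar_cut[OF \<eta>(1)] by (simp add: cochains_iff) (simp add: cut_def)
    moreover have "\<phi> xs = differential G k (cut k \<eta>) xs" for xs
      using out[of xs] \<eta>(3)[of xs] delta_cong_tup[of k "cut k \<eta>" \<eta> xs] Suc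
      by (auto simp: differential_eq cut_eq)
    ultimately show ?thesis
      by (auto simp: Suc coboundaries_def)
  qed
qed

lemma cls_eq_iff: "cls i \<phi> = cls i \<psi> \<longleftrightarrow> cohom \<Gamma> \<Gamma> i \<phi> \<psi>"
proof
  assume eq: "cls i \<phi> = cls i \<psi>"
  have c: "cohom \<Gamma> \<Gamma> i \<phi> (cut i \<phi>)"
    by (rule cohom_eq) (simp add: cut_eq)
  then have "cut i \<phi> \<in> cls i \<phi>"
    by (simp add: cls_def cohom_sym) (simp add: cut_def)
  then have "cohom \<Gamma> \<Gamma> i (cut i \<phi>) \<psi>"
    unfolding eq by (simp add: cls_def)
  with c show "cohom \<Gamma> \<Gamma> i \<phi> \<psi>" by (rule cohom_trans)
next
  assume "cohom \<Gamma> \<Gamma> i \<phi> \<psi>"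
  then show "cls i \<phi> = cls i \<psi>"
    unfolding cls_def using cohom_trans cohom_sym by blast
qed

lemma cut_in_cls: "cut i \<phi> \<in> cls i \<phi>"
  unfolding cls_def by (auto simp: cut_def intro!: cohom_eq)

text \<open>On tuples \<open>\<chi>\<close> is \<open>\<phi> + delta \<eta>\<close>, and the
  coboundary of the invariant \<open>\<eta>\<close> is invariant and closed.\<close>

lemma in_cls_cocycle:
  assumes "\<chi> \<in> cls i \<phi>" "cocycle i \<phi>"
  shows "cocycle i \<chi>"
proof -
  from assms(1) obtain \<eta> where out: "\<And>xs. xs \<notin> tup \<Gamma> i \<Longrightarrow> \<chi> xs = 0" and \<eta>: "invar \<Gamma> \<Gamma> \<eta>"
    and d: "\<And>xs. xs \<in> tup \<Gamma> i \<Longrightarrow> \<chi> xs - \<phi> xs = delta \<eta> xs"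
    by (auto simp: cls_def cohom_def)
  have d: "\<chi> xs = \<phi> xs + delta \<eta> xs" if "xs \<in> tup \<Gamma> i" for xs
    using d[OF that] by (simp add: algebra_simps)
  have inv: "\<chi> (map ((*) g) xs) = \<chi> xs" if "g \<in> \<Gamma>" "xs \<in> lists \<Gamma>" for g xs
  proof (cases "xs \<in> tup \<Gamma> i")
    case True
    have "delta \<eta> (map ((*) g) xs) = delta (\<lambda>ys. \<eta> (map ((*) g) ys)) xs"
      by (simp add: delta_map)
    also have "\<dots> = delta \<eta> xs"
      using \<eta> that unfolding invar_def in_lists_conv_set by (intro delta_cong) blast
    finally show ?thesis
      using True that assms(2) map_mult_tup[OF that(2,1), of i]
      by (simp add: d cocycle_def invar_def)
  next
    case False
    then show ?thesis
      using map_mult_tup[OF that(2,1), of i] by (simp add: out)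
  qed
  have "delta \<chi> xs = 0" if "xs \<in> tup \<Gamma> (i + 1)" for xs
  proof -
    have "delta \<chi> xs = delta (\<lambda>ys. \<phi> ys + delta \<eta> ys) xs"
      using d that by (rule delta_cong_tup)
    also have "\<dots> = 0"
      using assms(2) that by (simp add: delta_add delta_delta cocycle_def closed_cochain_def)
    finally show ?thesis .
  qed
  with inv show ?thesis
    by (simp add: cocycle_def invar_def closed_cochain_def)
qed

lemma cocycle_cut: "cocycle i \<phi> \<Longrightarrow> cut i \<phi> \<in> cocycles G i"
  using in_cls_cocycle[OF cut_in_cls] by (auto simp: cocycles_iff cut_def)

text \<open>The two forms serve \<open>cohomology\<close>, whose carrier is cut down to cocycles,
  and \<open>cohomology_map\<close>, which uses the full cochain space; the coset is the same set in
  both.\<close>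

lemma coset_eq_cls:
  assumes "\<And>xs. xs \<notin> tup \<Gamma> i \<Longrightarrow> \<phi> xs = 0"
  shows "coboundaries G i +>\<^bsub>cochain_space G i\<lparr>carrier := Z\<rparr>\<^esub> \<phi> = cls i \<phi>"
    and "coboundaries G i +>\<^bsub>cochain_space G i\<^esub> \<phi> = cls i \<phi>"
proof -
  have "{\<lambda>gs. \<eta> gs + \<phi> gs | \<eta>. \<eta> \<in> cls i (\<lambda>_. 0)} = cls i \<phi>"
  proof (intro equalityI subsetI)
    fix \<chi> assume "\<chi> \<in> {\<lambda>gs. \<eta> gs + \<phi> gs | \<eta>. \<eta> \<in> cls i (\<lambda>_. 0)}"
    then obtain \<eta> where \<eta>: "\<eta> \<in> cls i (\<lambda>_. 0)" "\<chi> = (\<lambda>gs. \<eta> gs + \<phi> gs)" by blast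
    then have "cohom \<Gamma> \<Gamma> i \<chi> (\<lambda>gs. 0 + \<phi> gs)"
      unfolding \<eta>(2) by (intro cohom_add cohom_refl) (simp add: cls_def)
    then show "\<chi> \<in> cls i \<phi>"
      using \<eta> assms by (simp add: cls_def)
  next
    fix \<chi> assume \<chi>: "\<chi> \<in> cls i \<phi>"
    have "cohom \<Gamma> \<Gamma> i (\<lambda>gs. \<chi> gs + (- 1) * \<phi> gs) (\<lambda>gs. \<phi> gs + (- 1) * \<phi> gs)"
      using \<chi> by (intro cohom_add cohom_refl) (simp add: cls_def)
    then have "(\<lambda>gs. \<chi> gs - \<phi> gs) \<in> cls i (\<lambda>_. 0)"
      using \<chi> assms by (simp add: cls_def)
    then show "\<chi> \<in> {\<lambda>gs. \<eta> gs + \<phi> gs | \<eta>. \<eta> \<in> cls i (\<lambda>_. 0)}"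
      by (intro CollectI exI[of _ "\<lambda>gs. \<chi> gs - \<phi> gs"]) simp
  qed
  then show "coboundaries G i +>\<^bsub>cochain_space G i\<lparr>carrier := Z\<rparr>\<^esub> \<phi> = cls i \<phi>"
    "coboundaries G i +>\<^bsub>cochain_space G i\<^esub> \<phi> = cls i \<phi>"
    by (auto simp: a_r_coset_def r_coset_def cochain_space_def coboundaries_eq)
qed

lemma in_cls_cut: "\<chi> \<in> cls i \<phi> \<Longrightarrow> cls i \<chi> = cls i \<phi>"
  unfolding cls_eq_iff by (simp add: cls_def)

section \<open>The vector space of cohomology classes\<close>

lemma carrier_cohomology: "carrier (cohomology G i) = {cls i \<phi> | \<phi>. cocycle i \<phi>}"
proof -
  have "carrier (cohomology G i) = (\<lambda>\<phi>. cls i \<phi>) ` cocycles G i"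
    unfolding cohomology_def quotient_module_def A_RCOSETS_def'
    by (auto simp: coset_eq_cls(1) cocycles_iff image_iff)
  also have "\<dots> = {cls i \<phi> | \<phi>. cocycle i \<phi>}"
  proof (intro equalityI subsetI)
    fix c assume "c \<in> {cls i \<phi> | \<phi>. cocycle i \<phi>}"
    then obtain \<phi> where "cocycle i \<phi>" "c = cls i \<phi>" by blast
    then show "c \<in> cls i ` cocycles G i"
      using cocycle_cut in_cls_cut[OF cut_in_cls, of i \<phi>] by blast
  qed (auto simp: cocycles_iff)
  finally show ?thesis .
qed

lemma zero_cohomology: "zero (cohomology G i) = cls i (\<lambda>_. 0)"
  by (simp add: cohomology_def quotient_module_def coboundaries_eq)

lemma add_cohomology: "add (cohomology G i) (cls i \<phi>) (cls i \<psi>) = cls i (\<lambda>xs. \<phi> xs + \<psi> xs)"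
proof -
  have "add (cohomology G i) (cls i \<phi>) (cls i \<psi>) = {\<lambda>gs. \<chi> gs + \<omega> gs | \<chi> \<omega>. \<chi> \<in> cls i \<phi> \<and> \<omega> \<in> cls i \<psi>}"
    by (auto simp: cohomology_def quotient_module_def set_add_def set_mult_def cochain_space_def)
  also have "\<dots> = cls i (\<lambda>xs. \<phi> xs + \<psi> xs)"
  proof (intro equalityI subsetI)
    fix \<chi> assume "\<chi> \<in> {\<lambda>gs. \<chi> gs + \<omega> gs | \<chi> \<omega>. \<chi> \<in> cls i \<phi> \<and> \<omega> \<in> cls i \<psi>}"
    then show "\<chi> \<in> cls i (\<lambda>xs. \<phi> xs + \<psi> xs)"
      by (auto simp: cls_def intro: cohom_add)
  next
    fix \<chi> assume \<chi>: "\<chi> \<in> cls i (\<lambda>xs. \<phi> xs + \<psi> xs)"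
    \<comment> \<open>The decomposition is
      \<open>\<chi> = (\<chi> - cut i \<psi>) + cut i \<psi>\<close>; with \<open>cut\<close> both
      summands vanish off the tuples and so belong to the classes.\<close>
    have "cohom \<Gamma> \<Gamma> i (\<lambda>gs. \<chi> gs + (- 1) * cut i \<psi> gs) (\<lambda>gs. (\<phi> gs + \<psi> gs) + (- 1) * cut i \<psi> gs)"
      using \<chi> by (intro cohom_add cohom_refl) (simp add: cls_def)
    also have "cohom \<Gamma> \<Gamma> i (\<lambda>gs. (\<phi> gs + \<psi> gs) + (- 1) * cut i \<psi> gs) \<phi>"
      by (rule cohom_eq) (simp add: cut_eq)
    finally have "(\<lambda>gs. \<chi> gs - cut i \<psi> gs) \<in> cls i \<phi>"
      using \<chi> by (simp add: cls_def) (simp add: cut_def)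
    then show "\<chi> \<in> {\<lambda>gs. \<chi> gs + \<omega> gs | \<chi> \<omega>. \<chi> \<in> cls i \<phi> \<and> \<omega> \<in> cls i \<psi>}"
      using cut_in_cls[of i \<psi>]
      by (intro CollectI exI[of _ "\<lambda>gs. \<chi> gs - cut i \<psi> gs"] exI[of _ "cut i \<psi>"]) simp
  qed
  finally show ?thesis .
qed

lemma smult_cohomology: "smult (cohomology G i) a (cls i \<phi>) = cls i (\<lambda>xs. a * \<phi> xs)"
proof -
  have "smult (cohomology G i) a (cls i \<phi>) = (\<Union>\<chi>\<in>cls i \<phi>. cls i (\<lambda>xs. a * \<chi> xs))"
    unfolding cohomology_def quotient_module_def
    by (auto simp: cls_def coset_eq_cls(1)[unfolded cls_def] cochain_space_def
        coset_eq_cls(1)[unfolded cls_def cochain_space_def, simplified])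
  also have "\<dots> = (\<Union>\<chi>\<in>cls i \<phi>. cls i (\<lambda>xs. a * \<phi> xs))"
  proof (rule SUP_cong[OF refl])
    fix \<chi> assume "\<chi> \<in> cls i \<phi>"
    then show "cls i (\<lambda>xs. a * \<chi> xs) = cls i (\<lambda>xs. a * \<phi> xs)"
      unfolding cls_eq_iff by (intro cohom_scale) (simp add: cls_def)
  qed
  also have "\<dots> = cls i (\<lambda>xs. a * \<phi> xs)"
    using cut_in_cls by blast
  finally show ?thesis .
qed

lemma cocycle_zero: "cocycle i (\<lambda>_. 0)"
  by (simp add: cocycle_def invar_def closed_cochain_def delta_zero)

lemma cocycle_add: "cocycle i \<phi> \<Longrightarrow> cocycle i \<psi> \<Longrightarrow> cocycle i (\<lambda>xs. \<phi> xs + \<psi> xs)"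
  by (simp add: cocycle_def invar_def closed_cochain_def delta_add)

lemma cocycle_scale: "cocycle i \<phi> \<Longrightarrow> cocycle i (\<lambda>xs. a * \<phi> xs)"
  by (simp add: cocycle_def invar_def closed_cochain_def delta_scale)

lemma cohomologyE:
  assumes "c \<in> carrier (cohomology G i)"
  obtains \<phi> where "cocycle i \<phi>" "c = cls i \<phi>"
  using assms by (auto simp: carrier_cohomology)

lemma cls_in_cohomology: "cocycle i \<phi> \<Longrightarrow> cls i \<phi> \<in> carrier (cohomology G i)"
  by (auto simp: carrier_cohomology)

lemma vectorspace_cohomology:
  "vectorspace class_ring (cohomology G i :: ('k::field, ('g list \<Rightarrow> 'k) set) module)"
proof -
  let ?H = "cohomology G i :: ('k, ('g list \<Rightarrow> 'k) set) module"
  have "abelian_group ?H"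
  proof (rule abelian_groupI)
    fix x y z assume "x \<in> carrier ?H" "y \<in> carrier ?H" "z \<in> carrier ?H"
    then obtain a b c where abc: "cocycle i a" "x = cls i a" "cocycle i b" "y = cls i b" "cocycle i c" "z = cls i c"
      by (metis cohomologyE)
    then show "x \<oplus>\<^bsub>?H\<^esub> y \<in> carrier ?H" "x \<oplus>\<^bsub>?H\<^esub> y \<oplus>\<^bsub>?H\<^esub> z = x \<oplus>\<^bsub>?H\<^esub> (y \<oplus>\<^bsub>?H\<^esub> z)"
      "x \<oplus>\<^bsub>?H\<^esub> y = y \<oplus>\<^bsub>?H\<^esub> x"
      by (simp_all add: add_cohomology cls_in_cohomology cocycle_add algebra_simps)
  next
    fix x assume "x \<in> carrier ?H"
    then obtain a where a: "cocycle i a" "x = cls i a" by (rule cohomologyE)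
    then show "\<zero>\<^bsub>?H\<^esub> \<oplus>\<^bsub>?H\<^esub> x = x"
      by (simp add: add_cohomology zero_cohomology)
    have "cls i (\<lambda>xs. (- 1) * a xs) \<oplus>\<^bsub>?H\<^esub> x = \<zero>\<^bsub>?H\<^esub>"
      unfolding a(2) add_cohomology zero_cohomology by simp
    then show "\<exists>y\<in>carrier ?H. y \<oplus>\<^bsub>?H\<^esub> x = \<zero>\<^bsub>?H\<^esub>"
      using cls_in_cohomology[OF cocycle_scale[OF a(1)]] by blast
  qed (simp add: zero_cohomology cls_in_cohomology cocycle_zero)
  then have "module class_ring ?H"
  proof (rule moduleI[OF class_cring.is_cring])
    fix r s :: 'k and x y assume "x \<in> carrier ?H" "y \<in> carrier ?H"
    then obtain a b where "cocycle i a" "x = cls i a" "cocycle i b" "y = cls i b"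
      by (metis cohomologyE)
    then show "r \<odot>\<^bsub>?H\<^esub> x \<in> carrier ?H" "r \<odot>\<^bsub>?H\<^esub> (x \<oplus>\<^bsub>?H\<^esub> y) = r \<odot>\<^bsub>?H\<^esub> x \<oplus>\<^bsub>?H\<^esub> r \<odot>\<^bsub>?H\<^esub> y"
      "(r \<oplus>\<^bsub>class_ring\<^esub> s) \<odot>\<^bsub>?H\<^esub> x = r \<odot>\<^bsub>?H\<^esub> x \<oplus>\<^bsub>?H\<^esub> s \<odot>\<^bsub>?H\<^esub> x"
      "(r \<otimes>\<^bsub>class_ring\<^esub> s) \<odot>\<^bsub>?H\<^esub> x = r \<odot>\<^bsub>?H\<^esub> (s \<odot>\<^bsub>?H\<^esub> x)"
      "\<one>\<^bsub>class_ring\<^esub> \<odot>\<^bsub>?H\<^esub> x = x"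
      by (simp_all add: add_cohomology smult_cohomology cls_in_cohomology cocycle_scale algebra_simps)
  qed
  then show ?thesis
    using class_field by (simp add: vectorspace_def)
qed

text \<open>If all representatives have cohomologous images, the union defining the induced map is a
  union of equal sets; well-definedness and the value come together.\<close>

lemma cohomology_map_eqI:
  assumes "\<And>\<chi>. \<chi> \<in> X \<Longrightarrow> cohom \<Gamma> \<Gamma> i (f \<chi>) \<psi>" "\<And>\<chi> xs. xs \<notin> tup \<Gamma> i \<Longrightarrow> f \<chi> xs = 0" "X \<noteq> {}"
  shows "cohomology_map G i f X = cls i \<psi>"
proof -
  have "coboundaries G i +>\<^bsub>cochain_space G i\<^esub> f \<chi> = cls i \<psi>" if "\<chi> \<in> X" for \<chi>
    using coset_eq_cls(2)[of i "f \<chi>"] assms(1)[OF that] assms(2) by (simp add: cls_eq_iff)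
  then show ?thesis
    using assms(3) by (auto simp: cohomology_map_def)
qed

end

section \<open>The functor on the 0-Hecke category\<close>

lemma concrete_group_borel: "concrete_group (borel_group m :: 'k::{finite,field} mat monoid)"
proof -
  have "group (borel_group m :: 'k mat monoid)"
    unfolding borel_group_def by (rule subgroup.subgroup_is_group[OF subgroup_borel group_GL])
  then show ?thesis
    by (intro concrete_group.intro) (simp_all add: concrete_group_axioms_def borel_group_simps)
qed

interpretation borel: concrete_group "borel_group m :: 'k::{finite,field} mat monoid"
  rewrites "carrier (borel_group m) = borel m" for m
  by (rule concrete_group_borel) (simp add: borel_group_simps)

definition hecke_cochain :: "nat \<Rightarrow> nat \<Rightarrow> nat \<Rightarrow> nat list \<Rightarrow> ('k mat list \<Rightarrow> 'k) \<Rightarrow> 'k mat list \<Rightarrow> 'k::{finite,field}" where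
  "hecke_cochain i n m u \<phi> = borel.cut m i (hecke_word m u (inflate n m \<phi>))"

text \<open>A word for the morphism is chosen arbitrarily; \<open>hecke_functor_cls\<close> shows
  that every word for it gives the same map on classes.\<close>

definition hecke_functor :: "nat \<Rightarrow> nat \<Rightarrow> nat \<Rightarrow> hecke_monoid set \<Rightarrow>
    ('k mat list \<Rightarrow> 'k) set \<Rightarrow> ('k mat list \<Rightarrow> 'k::{finite,field}) set" where
  "hecke_functor i n m f = cohomology_map (borel_group m) i
     (hecke_cochain i n m (SOME u. set u \<subseteq> {1..<m} \<and> f = hom_class n m (prod_list (map \<pi> u))))"

section \<open>Independence of the chosen word and cocycle\<close>

lemma zero_hecke_word:
  assumes "x \<in> \<M> m"
  obtains u where "set u \<subseteq> {1..<m}" "x = prod_list (map \<pi> u)"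
  using assms by (auto simp: zero_hecke_def)

lemma hecke_HomE:
  assumes "f \<in> hecke_Hom n m"
  obtains u where "n \<le> m" "set u \<subseteq> {1..<m}" "f = hom_class n m (prod_list (map \<pi> u))"
proof -
  have "n \<le> m" using assms by (auto simp: hecke_Hom_def split: if_splits)
  then obtain x where "x \<in> \<M> m" "f = hom_class n m x"
    using assms by (auto simp: hecke_Hom_def quotient_def hom_class_def)
  with zero_hecke_word that \<open>n \<le> m\<close> show ?thesis by metis
qed

lemma cohom_hecke_word_inflate:
  assumes "n \<le> m" "set u \<subseteq> {1..<m}" "cohom (borel n) (borel n) i \<phi> \<psi>"
  shows "cohom (borel m) (borel m) i (hecke_word m u (inflate n m \<phi>)) (hecke_word m u (inflate n m \<psi>))"
  using cohom_hecke_word[OF inflate(3)[OF assms(1,3)] word_stable_GL[OF assms(2)]] borel_subset_GL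
  by (rule cohom_mono)

lemma cocycle_hecke_word_inflate:
  fixes \<phi> :: "'k::{finite,field} mat list \<Rightarrow> 'k"
  assumes "n \<le> m" "set u \<subseteq> {1..<m}" "borel.cocycle n i \<phi>"
  shows "borel.cocycle m i (hecke_word m u (inflate n m \<phi>))"
proof -
  have "invar (borel m) (carrier (GL m)) (hecke_word m u (inflate n m \<phi>))"
    using assms by (intro invar_hecke_word inflate(1) word_stable_GL) (simp_all add: borel.cocycle_def)
  moreover have "closed_cochain (carrier (GL m)) i (hecke_word m u (inflate n m \<phi>))"
    using assms by (intro closed_hecke_word inflate(2) word_stable_GL) (simp_all add: borel.cocycle_def)
  ultimately show ?thesis
    unfolding borel.cocycle_def
    by (intro conjI invar_mono[OF _ borel_subset_GL] closed_cochain_mono[OF _ borel_subset_GL])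
qed

lemma hom_class_eqD:
  assumes "hom_class n m x = hom_class n m y" "x \<in> \<M> m" "y \<in> \<M> m"
  shows "(x, y) \<in> hom_equiv n m"
  using assms equiv_hom_equiv[of m n] unfolding hom_class_def by (simp add: eq_equiv_class)

text \<open>Induction along the chain of steps x ~ x\<pi>_j. The steps are between monoid elements
  but the operators are given by words: \<open>same\<close> changes the word of one element,
  \<open>absorb\<close> removes a last letter.\<close>

lemma cohom_hom_equiv:
  assumes nm: "n \<le> m" and u: "set u \<subseteq> {1..<m}" and v: "set v \<subseteq> {1..<m}"
    and eq: "hom_class n m (prod_list (map \<pi> u)) = hom_class n m (prod_list (map \<pi> v))"
    and \<phi>: "borel.cocycle n i \<phi>"
  shows "cohom (borel m) (carrier (GL m)) i (hecke_word m u (inflate n m \<phi>)) (hecke_word m v (inflate n m \<phi>))"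
proof -
  let ?W = "\<lambda>w. hecke_word m w (inflate n m \<phi>)"
  let ?R = "\<lambda>a b. a \<in> \<M> m \<and> (\<exists>j. n + 1 \<le> j \<and> j < m \<and> b = a * \<pi> j)"
  have \<phi>: "invar (borel n) (borel n) \<phi>" "closed_cochain (borel n) i \<phi>"
    using \<phi> by (simp_all add: borel.cocycle_def)
  note inv = inflate(1)[OF nm \<phi>(1)]
  have same: "cohom (borel m) (carrier (GL m)) i (?W w) (?W w')"
    if "prod_list (map \<pi> w) = prod_list (map \<pi> w')" "set w \<subseteq> {1..<m}" for w w'
    using that hecke_word_hecke_eq[OF _ _ inv] by (intro cohom_eq) (simp add: prod_list_hecke_gen_eq_iff)
  \<comment> \<open>The appended letter acts first, directly on the inflated cocycle, and at
    position \<open>j - 1\<close>, which is at least \<open>n\<close>.\<close>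
  have absorb: "cohom (borel m) (carrier (GL m)) i (?W (w @ [j])) (?W w)"
    if "set w \<subseteq> {1..<m}" "n + 1 \<le> j" "j < m" for w j
    using cohom_hecke_word[OF hecke_P_inflate[OF _ _ \<phi>] word_stable_GL[OF that(1)], of "j - 1"] that
    by simp
  have "prod_list (map \<pi> u) \<in> \<M> m" "prod_list (map \<pi> v) \<in> \<M> m"
    using u v by (auto simp: zero_hecke_def)
  from hom_class_eqD[OF eq this] have "equivclp ?R (prod_list (map \<pi> u)) (prod_list (map \<pi> v))"
    by (simp add: hom_equiv_def)
  \<comment> \<open>All words for the current element are allowed, so that the induction can pass to
    one ending in the required letter.\<close>
  then have "\<forall>w. set w \<subseteq> {1..<m} \<longrightarrow> prod_list (map \<pi> v) = prod_list (map \<pi> w) \<longrightarrow>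
      cohom (borel m) (carrier (GL m)) i (?W u) (?W w)"
  proof (induction rule: equivclp_induct)
    case base
    then show ?case using same u by blast
  next
    case (step y z)
    show ?case
    proof (intro allI impI)
      fix w assume w: "set w \<subseteq> {1..<m}" "z = prod_list (map \<pi> w)"
      from step.hyps(2) consider "?R y z" | "?R z y"
        by (auto simp: symclp_def)
      then show "cohom (borel m) (carrier (GL m)) i (?W u) (?W w)"
      proof cases
        case 1
        then obtain j where y: "y \<in> \<M> m" and j: "n + 1 \<le> j" "j < m" "z = y * \<pi> j" by blast
        from y obtain w' where w': "set w' \<subseteq> {1..<m}" "y = prod_list (map \<pi> w')"
          by (rule zero_hecke_word)
        have "cohom (borel m) (carrier (GL m)) i (?W u) (?W w')"
          using step.IH w' by blast
        also have "cohom (borel m) (carrier (GL m)) i (?W w') (?W (w' @ [j]))"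
          using absorb[OF w'(1) j(1,2)] by (rule cohom_sym)
        also have "cohom (borel m) (carrier (GL m)) i (?W (w' @ [j])) (?W w)"
          using w w' j by (intro same) auto
        finally show ?thesis .
      next
        case 2
        then obtain j where j: "n + 1 \<le> j" "j < m" "y = z * \<pi> j" by blast
        then have "y = prod_list (map \<pi> (w @ [j]))" "set (w @ [j]) \<subseteq> {1..<m}"
          using w by auto
        then have "cohom (borel m) (carrier (GL m)) i (?W u) (?W (w @ [j]))"
          using step.IH by blast
        also have "cohom (borel m) (carrier (GL m)) i \<dots> (?W w)"
          using w(1) j(1,2) by (rule absorb)
        finally show ?thesis .
      qed
    qed
  qed
  then show ?thesis using v by blast
qed

lemma cls_nonempty: "borel.cls m i \<phi> \<noteq> {}"
  using borel.cut_in_cls by blast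

lemma hecke_functor_cls:
  assumes nm: "n \<le> m" and u: "set u \<subseteq> {1..<m}" and \<phi>: "borel.cocycle n i \<phi>"
  shows "hecke_functor i n m (hom_class n m (prod_list (map \<pi> u))) (borel.cls n i \<phi>) =
    borel.cls m i (hecke_word m u (inflate n m \<phi>))"
proof -
  let ?f = "hom_class n m (prod_list (map \<pi> u))"
  define v where "v = (SOME v. set v \<subseteq> {1..<m} \<and> ?f = hom_class n m (prod_list (map \<pi> v)))"
  have v: "set v \<subseteq> {1..<m}" "?f = hom_class n m (prod_list (map \<pi> v))"
    using someI[of "\<lambda>v. set v \<subseteq> {1..<m} \<and> ?f = hom_class n m (prod_list (map \<pi> v))" u] u
    by (simp_all add: v_def)
  have "cohom (borel m) (borel m) i (hecke_cochain i n m v \<chi>) (hecke_word m u (inflate n m \<phi>))"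
    if "\<chi> \<in> borel.cls n i \<phi>" for \<chi>
  proof -
    have "cohom (borel m) (borel m) i (hecke_cochain i n m v \<chi>) (hecke_word m v (inflate n m \<chi>))"
      by (rule cohom_eq) (simp add: hecke_cochain_def borel.cut_eq)
    also have "cohom (borel m) (borel m) i \<dots> (hecke_word m v (inflate n m \<phi>))"
      using that by (intro cohom_hecke_word_inflate nm v) (simp add: borel.cls_def)
    also have "cohom (borel m) (borel m) i \<dots> (hecke_word m u (inflate n m \<phi>))"
      by (rule cohom_mono[OF cohom_sym[OF cohom_hom_equiv[OF nm u v \<phi>]] borel_subset_GL])
    finally show ?thesis .
  qed
  then show ?thesis
    unfolding hecke_functor_def v_def[symmetric]
    by (rule borel.cohomology_map_eqI) (simp_all add: hecke_cochain_def borel.cut_def cls_nonempty)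
qed

section \<open>Functor laws and identification with the given operators\<close>

lemma borel_cohomologyE:
  assumes "c \<in> carrier (borel_cohomology i n)"
  obtains \<phi> where "borel.cocycle n i \<phi>" "c = borel.cls n i \<phi>"
  using assms unfolding borel_cohomology_def by (rule borel.cohomologyE)

lemma restrict_mat_borel: "b \<in> borel n \<Longrightarrow> restrict_mat n b = b"
  by (intro eq_matI) (auto simp: restrict_mat_def dest!: borel_carrier_mat)

lemma equivariant_inflate_self:
  "equivariant (borel n) (carrier (GL n)) (borel n) (borel n) id (restrict_mat n \<circ> retraction n)"
  using equivariant_inflate[of n n] unfolding equivariant_def by (auto simp: restrict_mat_borel)

text \<open>On the Borel subgroup the retraction is right multiplication by its value at the unit,
  not necessarily the identity; being equivariant, it is homotopic to the identity.\<close>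

lemma inflate_self:
  fixes \<phi> :: "'k::{finite,field} mat list \<Rightarrow> 'k"
  assumes "borel.cocycle n i \<phi>"
  shows "cohom (borel n) (borel n) i (inflate n n \<phi>) \<phi>"
proof -
  have "cohom (borel n) (borel n) i (inflate n n \<phi>) (\<lambda>xs. \<phi> (map id xs))"
    unfolding inflate_def[abs_def] using assms
    by (intro cohom_homotopy[OF _ _ _ equivariant_mono[OF equivariant_inflate_self borel_subset_GL order_refl]])
      (simp_all add: borel.cocycle_def equivariant_def)
  then show ?thesis by simp
qed

lemma hecke_functor_module:
  "hecke_category_module (borel_cohomology i :: nat \<Rightarrow> ('k::{finite,field}, ('k mat list \<Rightarrow> 'k) set) module)
    (hecke_functor i)"
proof (rule hecke_category_module.intro)
  let ?H = "borel_cohomology i :: nat \<Rightarrow> ('k, ('k mat list \<Rightarrow> 'k) set) module"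
  show vs: "vectorspace class_ring (?H n)" for n
    unfolding borel_cohomology_def by (rule borel.vectorspace_cohomology)
  show "linear_map class_ring (?H n) (?H m) (hecke_functor i n m f)" if "f \<in> hecke_Hom n m" for f n m
  proof -
    from that obtain u where u: "n \<le> m" "set u \<subseteq> {1..<m}" "f = hom_class n m (prod_list (map \<pi> u))"
      by (rule hecke_HomE)
    note F = hecke_functor_cls[OF u(1,2), folded u(3)]
    have "hecke_functor i n m f \<in> LinearCombinations.module_hom class_ring (?H n) (?H m)"
      unfolding LinearCombinations.module_hom_def
    proof (intro CollectI conjI allI impI Pi_I)
      fix x y assume "x \<in> carrier (?H n) \<and> y \<in> carrier (?H n)"
      then obtain a b where ab: "borel.cocycle n i a" "x = borel.cls n i a" "borel.cocycle n i b" "y = borel.cls n i b"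
        by (metis borel_cohomologyE)
      then show "hecke_functor i n m f (x \<oplus>\<^bsub>?H n\<^esub> y) = hecke_functor i n m f x \<oplus>\<^bsub>?H m\<^esub> hecke_functor i n m f y"
        by (simp add: borel_cohomology_def borel.add_cohomology borel.cocycle_add F inflate_def[abs_def] hecke_word_add)
    next
      fix x assume "x \<in> carrier (?H n)"
      then obtain a where "borel.cocycle n i a" "x = borel.cls n i a"
        by (rule borel_cohomologyE)
      then show "hecke_functor i n m f x \<in> carrier (?H m)"
        using borel.cls_in_cohomology[OF cocycle_hecke_word_inflate[OF u(1,2)]]
        by (simp add: borel_cohomology_def F)
    next
      fix x and r :: 'k assume "r \<in> carrier class_ring \<and> x \<in> carrier (?H n)"
      then obtain a where "borel.cocycle n i a" "x = borel.cls n i a"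
        by (metis borel_cohomologyE)
      then show "hecke_functor i n m f (r \<odot>\<^bsub>?H n\<^esub> x) = r \<odot>\<^bsub>?H m\<^esub> hecke_functor i n m f x"
        by (simp add: borel_cohomology_def borel.smult_cohomology borel.cocycle_scale F inflate_def[abs_def] hecke_word_scale)
    qed
    with vs[of n] vs[of m] show ?thesis
      by (simp add: linear_map_def mod_hom_def mod_hom_axioms_def vectorspace_def)
  qed
  show "hecke_functor i n n (hom_class n n 1) x = x" if "x \<in> carrier (?H n)" for x n
  proof -
    from that obtain a where a: "borel.cocycle n i a" "x = borel.cls n i a"
      by (rule borel_cohomologyE)
    then show ?thesis
      using hecke_functor_cls[OF order_refl, of "[]" n i a] inflate_self[OF a(1)]
      by (simp add: borel.cls_eq_iff)
  qed
  show "hecke_functor i n l (hecke_comp n l g f) x = hecke_functor i m l g (hecke_functor i n m f x)"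
    if f: "f \<in> hecke_Hom n m" and g: "g \<in> hecke_Hom m l" and x: "x \<in> carrier (?H n)" for f g x n m l
  proof -
    from f obtain v where v: "n \<le> m" "set v \<subseteq> {1..<m}" "f = hom_class n m (prod_list (map \<pi> v))"
      by (rule hecke_HomE)
    from g obtain u where u: "m \<le> l" "set u \<subseteq> {1..<l}" "g = hom_class m l (prod_list (map \<pi> u))"
      by (rule hecke_HomE)
    from x obtain a where a: "borel.cocycle n i a" "x = borel.cls n i a"
      by (rule borel_cohomologyE)
    have "prod_list (map \<pi> v) \<in> \<M> m" "prod_list (map \<pi> u) \<in> \<M> l"
      using u v by (auto simp: zero_hecke_def)
    then have "hecke_comp n l g f = hom_class n l (prod_list (map \<pi> (u @ v)))"
      unfolding u(3) v(3) using hecke_comp_class u(1) v(1) by simp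
    moreover have "set (u @ v) \<subseteq> {1..<l}" "n \<le> l"
      using u v by auto
    ultimately have "hecke_functor i n l (hecke_comp n l g f) x =
        borel.cls l i (hecke_word l u (hecke_word l v (inflate n l a)))"
      using hecke_functor_cls[of n l "u @ v" i a] a by simp
    moreover have "hecke_functor i m l g (hecke_functor i n m f x) =
        borel.cls l i (hecke_word l u (inflate m l (hecke_word m v (inflate n m a))))"
      unfolding u(3) v(3) a(2)
      using hecke_functor_cls[OF v(1,2) a(1)] hecke_functor_cls[OF u(1,2) cocycle_hecke_word_inflate[OF v(1,2) a(1)]]
      by simp
    \<comment> \<open>Functoriality reduces to moving \<open>v\<close> past the inflation from
      \<open>m\<close> to \<open>l\<close>; the word \<open>u\<close> then acts on cohomologous
      functions.\<close>
    moreover have "cohom (borel l) (borel l) i (hecke_word l u (inflate m l (hecke_word m v (inflate n m a))))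
        (hecke_word l u (hecke_word l v (inflate n l a)))"
      using a(1) unfolding borel.cocycle_def
      by (intro cohom_mono[OF cohom_hecke_word borel_subset_GL] word_stable_GL inflate_hecke_word u(1,2) v(1,2))
        simp_all
    ultimately show ?thesis
      by (simp add: borel.cls_eq_iff cohom_sym)
  qed
qed

text \<open>A retraction \<open>r\<close> with value 1 on \<open>R\<close> turns
  \<xi>_\<alpha>(\<gamma>) into r(\<alpha>\<gamma>). The operator then sums translates of the
  extension of the cochain along \<open>r\<close>, and by left invariance the sum over
  \<open>R\<close> equals the sum over the \<open>sw n p t\<close>.\<close>

lemma hecke_operator_cls:
  fixes R :: "'k::{finite,field} mat set"
  assumes p: "Suc p < n" and R: "coset_reps (GL n) (borel n) (sw n p 0) R" and \<phi>: "borel.cocycle n i \<phi>"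
  shows "hecke_operator (GL n) (borel n) R i (borel.cls n i \<phi>) = borel.cls n i (hecke_T n p (inflate n n \<phi>))"
proof -
  let ?G = "GL n :: 'k mat monoid" and ?B = "borel n :: 'k mat set"
  have RG: "R \<subseteq> carrier ?G" and dis: "disjoint_family_on (\<lambda>\<alpha>. ?B #>\<^bsub>?G\<^esub> \<alpha>) R"
    using R by (auto simp: coset_reps_def)
  from ex_borel_retraction[OF RG dis] obtain r where r: "equivariant ?B (carrier ?G) ?B ?B id r" "\<forall>\<alpha>\<in>R. r \<alpha> = 1\<^sub>m n"
    by blast
  have xi: "hecke_xi ?G ?B R \<alpha> \<gamma> = r (\<alpha> * \<gamma>)" if "\<alpha> \<in> R" "\<gamma> \<in> ?B" for \<alpha> \<gamma>
    using group.hecke_xi_retraction[OF group_GL subgroup_borel R sw_in_GL[OF p] _ _ that, of r] r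
    by (simp add: GL_mult GL_one equivariant_def)
  have G: "?G\<lparr>carrier := ?B\<rparr> = borel_group n" by (simp add: borel_group_def)
  have main: "hecke_cochain_map ?G ?B R i \<chi> xs = hecke_T n p (\<lambda>ys. \<chi> (map r ys)) xs"
    if \<chi>: "invar ?B ?B \<chi>" and xs: "xs \<in> tup ?B i" for \<chi> xs
  proof -
    have xsG: "xs \<in> lists (carrier ?G)"
      using xs borel_subset_GL by (auto simp: tup_def)
    define h where "h \<alpha> = \<chi> (map r (map ((*) \<alpha>) xs))" for \<alpha>
    have inv: "h (b \<otimes>\<^bsub>?G\<^esub> \<alpha>) = h \<alpha>" if "b \<in> ?B" "\<alpha> \<in> carrier ?G" for b \<alpha>
      using invar_map_mult[OF invar_pullback[OF \<chi> r(1)] stable_GL[OF p] that _ xsG] that(2)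
      by (simp add: h_def GL_mult GL_mult_closed del: map_map)
    have "map (hecke_xi ?G ?B R \<alpha>) xs = map r (map ((*) \<alpha>) xs)" if "\<alpha> \<in> R" for \<alpha>
      using xs xi[OF that] by (auto simp: tup_def subset_iff)
    then have "hecke_cochain_map ?G ?B R i \<chi> xs = sum h R"
      unfolding hecke_cochain_map_def G borel.tuples_eq h_def
      using xs by (simp del: map_map)
    also have "\<dots> = sum h (range (sw n p))"
      using group.sum_coset_reps[OF group_GL subgroup_borel R inv]
        group.sum_coset_reps[OF group_GL subgroup_borel sw_coset_reps[OF p] inv] by simp
    also have "\<dots> = hecke_T n p (\<lambda>ys. \<chi> (map r ys)) xs"
      by (simp add: sum.reindex[OF inj_sw[OF p]] hecke_T_def h_def)
    finally show ?thesis .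
  qed
  show ?thesis
    unfolding hecke_operator_def G
  proof (rule borel.cohomology_map_eqI)
    fix \<chi> assume \<chi>: "\<chi> \<in> borel.cls n i \<phi>"
    have c: "invar ?B ?B \<phi>" "closed_cochain ?B i \<phi>" and inv: "invar ?B ?B \<chi>"
      using \<phi> borel.in_cls_cocycle[OF \<chi> \<phi>] by (simp_all add: borel.cocycle_def)
    have "cohom ?B ?B i (hecke_cochain_map ?G ?B R i \<chi>) (hecke_T n p (\<lambda>ys. \<chi> (map r ys)))"
      by (rule cohom_eq) (rule main[OF inv])
    also have "cohom ?B ?B i \<dots> (hecke_T n p (inflate n n \<phi>))"
    proof (intro cohom_mono[OF cohom_hecke_T borel_subset_GL] stable_GL p)
      have "cohom ?B (carrier ?G) i (\<lambda>ys. \<chi> (map r ys)) (\<lambda>ys. \<phi> (map r ys))"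
        using \<chi> r(1) by (intro cohom_pullback[of ?B ?B]) (simp_all add: borel.cls_def)
      \<comment> \<open>The map \<open>r\<close> was fitted to \<open>R\<close>, while
        \<open>inflate\<close> uses the fixed retraction; both are equivariant, hence
        homotopic.\<close>
      also have "cohom ?B (carrier ?G) i \<dots> (inflate n n \<phi>)"
        unfolding inflate_def[abs_def] using c equivariant_inflate_self r(1) by (rule cohom_homotopy)
      finally show "cohom ?B (carrier ?G) i (\<lambda>ys. \<chi> (map r ys)) (inflate n n \<phi>)" .
    qed
    finally show "cohom ?B ?B i (hecke_cochain_map ?G ?B R i \<chi>) (hecke_T n p (inflate n n \<phi>))" .
  next
    show "hecke_cochain_map ?G ?B R i \<chi> xs = 0" if "xs \<notin> tup ?B i" for \<chi> xs
      using that by (simp add: hecke_cochain_map_def G borel.tuples_eq)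
  qed (rule cls_nonempty)
qed

theorem theorem1p3:
  fixes i :: nat
  shows "\<exists>F. hecke_category_module
      (borel_cohomology i :: nat \<Rightarrow> ('k::{finite,field}, ('k mat list \<Rightarrow> 'k) set) module) F \<and>
    (\<forall>n j R. 1 \<le> j \<and> j < n \<and> coset_reps (GL n) (borel n) (swap_matrix n j) R \<longrightarrow>
      (\<forall>c\<in>carrier (borel_cohomology i n).
        F n n (hom_class n n (\<pi> j)) c =
          hecke_operator (GL n) (borel n) R i c \<oplus>\<^bsub>borel_cohomology i n\<^esub> c)) \<and>
    (\<forall>n. \<forall>c\<in>carrier (borel_cohomology i n). F n (n + 1) (\<iota> n (n + 1)) c = \<Phi> i n c)"
proof (intro exI[of _ "hecke_functor i"] conjI allI impI ballI)
  show "hecke_category_module (borel_cohomology i :: nat \<Rightarrow> ('k, ('k mat list \<Rightarrow> 'k) set) module)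
      (hecke_functor i)"
    by (rule hecke_functor_module)
next
  fix n j and R :: "'k mat set" and c
  assume *: "1 \<le> j \<and> j < n \<and> coset_reps (GL n) (borel n) (swap_matrix n j) R"
    and "c \<in> carrier (borel_cohomology i n :: ('k, ('k mat list \<Rightarrow> 'k) set) module)"
  then obtain \<phi> where \<phi>: "borel.cocycle n i \<phi>" "c = borel.cls n i \<phi>"
    by (metis borel_cohomologyE)
  have p: "Suc (j - 1) < n" and R: "coset_reps (GL n) (borel n) (sw n (j - 1) 0) R"
    using * by (auto simp: swap_matrix_eq)
  have "hecke_functor i n n (hom_class n n (\<pi> j)) c = borel.cls n i (hecke_P n (j - 1) (inflate n n \<phi>))"
    using hecke_functor_cls[of n n "[j]" i \<phi>] * \<phi> by simp
  \<comment> \<open>Only the identity summand of P = 1 + T changes here: its inflated cocycle is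
    replaced by the original one.\<close>
  also have "\<dots> = borel.cls n i (\<lambda>xs. hecke_T n (j - 1) (inflate n n \<phi>) xs + \<phi> xs)"
    unfolding borel.cls_eq_iff hecke_P_eq
    using cohom_add[OF cohom_refl inflate_self[OF \<phi>(1)], of "hecke_T n (j - 1) (inflate n n \<phi>)"]
    by (simp add: add.commute)
  finally show "hecke_functor i n n (hom_class n n (\<pi> j)) c =
      hecke_operator (GL n) (borel n) R i c \<oplus>\<^bsub>borel_cohomology i n\<^esub> c"
    unfolding \<phi>(2) hecke_operator_cls[OF p R \<phi>(1)] borel_cohomology_def borel.add_cohomology .
next
  fix n c
  assume "c \<in> carrier (borel_cohomology i n :: ('k, ('k mat list \<Rightarrow> 'k) set) module)"
  then obtain \<phi> where \<phi>: "borel.cocycle n i \<phi>" "c = borel.cls n i \<phi>"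
    by (rule borel_cohomologyE)
  let ?m = "n + 1"
  have "hecke_functor i n ?m (\<iota> n ?m) c = borel.cls ?m i (inflate n ?m \<phi>)"
    using hecke_functor_cls[of n ?m "[]" i \<phi>] \<phi> by (simp add: principal_inj_def)
  also have "\<dots> = \<Phi> i n c"
    unfolding Phi_def
  proof (rule sym, rule borel.cohomology_map_eqI)
    fix \<chi> assume "\<chi> \<in> c"
    then have \<chi>: "cohom (borel n) (borel n) i \<chi> \<phi>"
      by (simp add: \<phi>(2) borel.cls_def)
    have nm: "n \<le> ?m" by simp
    have "cohom (borel ?m) (borel ?m) i (pullback (borel_group ?m) i (restrict_mat n) \<chi>)
        (\<lambda>xs. \<chi> (map (restrict_mat n) xs))"
      by (rule cohom_eq) (simp add: pullback_def borel.tuples_eq)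
    also have "cohom (borel ?m) (borel ?m) i \<dots> (\<lambda>xs. \<phi> (map (restrict_mat n) xs))"
      using \<chi> equivariant_restrict_mat(1)[OF nm] by (rule cohom_pullback)
    \<comment> \<open>Plain restriction, used in \<open>\<Phi>\<close>, and restriction after
      retraction are both equivariant along the restriction of groups.\<close>
    also have "cohom (borel ?m) (borel ?m) i \<dots> (inflate n ?m \<phi>)"
      unfolding inflate_def[abs_def]
      using \<phi>(1) by (intro cohom_homotopy[OF _ _ _ equivariant_restrict_mat(1)[OF nm]]
          equivariant_mono[OF equivariant_inflate[OF nm] borel_subset_GL order_refl]) (simp_all add: borel.cocycle_def)
    finally show "cohom (borel ?m) (borel ?m) i (pullback (borel_group ?m) i (restrict_mat n) \<chi>) (inflate n ?m \<phi>)" .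
  next
    show "pullback (borel_group ?m) i (restrict_mat n) \<chi> xs = 0" if "xs \<notin> tup (borel ?m) i"
      for \<chi> and xs :: "'k mat list"
      using that by (simp add: pullback_def borel.tuples_eq)
  qed (simp add: \<phi>(2) cls_nonempty)
  finally show "hecke_functor i n ?m (\<iota> n ?m) c = \<Phi> i n c" .
qed

end
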